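(* For $|q|<1$, $$\mathrm{C}\Phi_{11}(q)=\frac{1}{(q^{11};q^{11})_\infty}+11\sum_{j=1}^\infty p(11j-5)q^j.$$
   Context: A $k$-colored generalized Frobenius symbol is a two-row array with $d\ge 0$ columns whose entries are colored nonnegative integers $\ell_c$ ($\ell\ge 0$, color $c\in\{1,\dots,k\}$), each row strictly decreasing with respect to the total order $0_1\prec 0_2\prec\cdots\prec 0_k\prec 1_1\prec\cdots\prec 1_k\prec 2_1\prec\cdots$. It is a $k$-colored generalized Frobenius partition of $n=d+\sum(\text{integer values of all entries})$. $c\phi_k(n)$ is the number of such partitions of $n$ (with $c\phi_k(0)=1$), and $\mathrm{C}\Phi_k(q)=\sum_{n\ge0}c\phi_k(n)q^n$. $(a;q)_\infty=\prod_{j\ge1}(1-aq^{j-1})$ and $p(n)$ is the number of ordinary partitions of $n$. *)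

theory Defs
  imports "HOL-Analysis.Analysis" "HOL-Library.Multiset"
begin

text \<open>The pair \<open>(l, c)\<close> represents the coloured integer \<open>l\<^sub>c\<close>: value \<open>l\<close>, colour \<open>c\<close>.\<close>

type_synonym colored = "nat \<times> nat"

definition colored_less :: "colored \<Rightarrow> colored \<Rightarrow> bool" where
  "colored_less x y \<longleftrightarrow> fst x < fst y \<or> (fst x = fst y \<and> snd x < snd y)"

definition frobenius_row :: "nat \<Rightarrow> colored list \<Rightarrow> bool" where
  "frobenius_row k r \<longleftrightarrow>
     (\<forall>x\<in>set r. snd x \<in> {1..k}) \<and> sorted_wrt (\<lambda>x y. colored_less y x) r"

definition frobenius_symbol :: "nat \<Rightarrow> colored list \<times> colored list \<Rightarrow> bool" where
  "frobenius_symbol k s \<longleftrightarrow>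
     frobenius_row k (fst s) \<and> frobenius_row k (snd s) \<and> length (fst s) = length (snd s)"

definition frobenius_size :: "colored list \<times> colored list \<Rightarrow> nat" where
  "frobenius_size s =
     length (fst s) + sum_list (map fst (fst s)) + sum_list (map fst (snd s))"

definition frobenius_partitions :: "nat \<Rightarrow> nat \<Rightarrow> (colored list \<times> colored list) set" where
  "frobenius_partitions k n = {s. frobenius_symbol k s \<and> frobenius_size s = n}"

definition cphi :: "nat \<Rightarrow> nat \<Rightarrow> nat" where
  "cphi k n = card (frobenius_partitions k n)"

definition CPhi :: "nat \<Rightarrow> complex \<Rightarrow> complex" where
  "CPhi k q = (\<Sum>n. of_nat (cphi k n) * q ^ n)"

text \<open>The product is indexed from \<open>0\<close>, so the exponent \<open>j - 1\<close> becomes \<open>j\<close>.\<close>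

definition qpoch_inf :: "complex \<Rightarrow> complex \<Rightarrow> complex" where
  "qpoch_inf a q = (\<Prod>j. 1 - a * q ^ j)"

definition partition_number :: "nat \<Rightarrow> nat" where
  "partition_number n = card {M :: nat multiset. 0 \<notin># M \<and> sum_mset M = n}"

text \<open>Neither cardinality above is the default value for infinite sets.\<close>

lemma finite_frobenius_partitions: "finite (frobenius_partitions k n)"
proof -
  let ?L = "{xs. set xs \<subseteq> {..n} \<times> {1..k} \<and> length xs \<le> n}"
  have row: "r \<in> ?L"
    if "frobenius_row k r" "length r \<le> n" "sum_list (map fst r) \<le> n" for r
  proof -
    have "fst x \<le> n" if "x \<in> set r" for x
      using member_le_sum_list[of "fst x" "map fst r"] that \<open>sum_list (map fst r) \<le> n\<close>
      by fastforce
    then show ?thesis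
      using that by (auto simp: frobenius_row_def)
  qed
  have "frobenius_partitions k n \<subseteq> ?L \<times> ?L"
  proof
    fix s assume "s \<in> frobenius_partitions k n"
    then have "fst s \<in> ?L" "snd s \<in> ?L"
      by (intro row; simp add: frobenius_partitions_def frobenius_symbol_def frobenius_size_def)+
    then show "s \<in> ?L \<times> ?L"
      by (simp add: mem_Times_iff)
  qed
  moreover have "finite ?L"
    by (rule finite_lists_length_le) simp
  ultimately show ?thesis
    by (meson finite_SigmaI finite_subset)
qed

lemma finite_partitions: "finite {M :: nat multiset. 0 \<notin># M \<and> sum_mset M = n}"
proof -
  have "size M \<le> sum_mset M" if "0 \<notin># M" for M :: "nat multiset"
    using that by (induction M) auto
  moreover have "x \<le> sum_mset M" if "x \<in># M" for x and M :: "nat multiset"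
    using that by (metis le_add1 multi_member_split sum_mset.add_mset)
  ultimately have bounds: "size M \<le> n \<and> set_mset M \<subseteq> {..n}"
    if "0 \<notin># M" "sum_mset M = n" for M :: "nat multiset"
    using that by auto
  have "{M :: nat multiset. 0 \<notin># M \<and> sum_mset M = n}
      \<subseteq> mset ` {xs. set xs \<subseteq> {..n} \<and> length xs \<le> n}"
  proof
    fix M :: "nat multiset" assume "M \<in> {M. 0 \<notin># M \<and> sum_mset M = n}"
    then have "size M \<le> n \<and> set_mset M \<subseteq> {..n}"
      using bounds by simp
    moreover obtain xs where "mset xs = M"
      using ex_mset by blast
    ultimately show "M \<in> mset ` {xs. set xs \<subseteq> {..n} \<and> length xs \<le> n}"
      by (intro image_eqI[of _ _ xs]) auto
  qed
  then show ?thesis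
    by (rule finite_subset) (simp add: finite_lists_length_le)
qed

lemma cphi_0: "cphi k 0 = 1"
proof -
  have "frobenius_partitions k 0 = {([], [])}"
    by (auto simp: frobenius_partitions_def frobenius_symbol_def frobenius_size_def frobenius_row_def)
  then show ?thesis
    by (simp add: cphi_def)
qed

end

theory Submission
  imports Defs
begin

text \<open>
  A Frobenius symbol is a Maya diagram of charge zero, that is, a set of integers differing from
  the negative ones in finitely many places, with as many integers gained as lost. Every weight in
  sight is then a regularised sum over the diagram: of \<open>s\<close> for ordinary partitions (in
  Frobenius coordinates), and of \<open>s div 11\<close> for 11-coloured symbols, the residue
  \<open>s mod 11\<close> being the colour.

  Rotating the colours at one level (the integers with a given \<open>s div 11\<close>) that is
  neither full nor empty keeps the weight and changes the colour sum by a nonzero residue modulo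
  11. Hence the symbols with such a level are equidistributed over the eleven colour sums, while the
  others are ordinary symbols of one eleventh of the weight. It remains to see that the symbols of
  weight \<open>n\<close> with colour sum 1 are equinumerous with the partitions of
  \<open>11 n - 5\<close>.

  In both cases a diagram amounts to eleven uncharged diagrams together with a vector \<open>c\<close>
  of charges in the root lattice of type A10. With \<open>w\<^sub>j = 11 c\<^sub>j + j - 5\<close>, partitions of
  \<open>11 n - 5\<close> correspond to vectors \<open>w\<close> whose norm is divisible by 121,
  whereas the symbols with colour sum 1 correspond to charges \<open>c\<close> with
  \<open>\<Sum>i c\<^sub>i \<equiv> 1 (mod 11)\<close>.
  An integral 11 by 11 matrix that is 11 times an orthogonal one, with \<open>(i, j)\<close> entry
  congruent to \<open>i (j - 5)\<close>, exchanges the two sets of vectors.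
\<close>

section \<open>Maya diagrams\<close>

definition maya :: "int set \<Rightarrow> bool" where
  "maya S \<longleftrightarrow> finite {s. (s \<in> S) \<noteq> (s < 0)}"

text \<open>The formal difference between the sum of \<open>g\<close> over \<open>S\<close> and its
  sum over the vacuum, the set of negative integers: a particle (nonnegative member) counts
  \<open>g s\<close>, a hole (missing negative) counts \<open>- g s\<close>.\<close>

definition rsum :: "(int \<Rightarrow> int) \<Rightarrow> int set \<Rightarrow> int" where
  "rsum g S = (\<Sum>s | (s \<in> S) \<noteq> (s < 0). g s * (of_bool (s \<in> S) - of_bool (s < 0)))"

abbreviation charge :: "int set \<Rightarrow> int" where
  "charge S \<equiv> rsum (\<lambda>_. 1) S"

abbreviation energy :: "int set \<Rightarrow> int" where
  "energy S \<equiv> rsum (\<lambda>s. s) S"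

text \<open>Terms off the support vanish, so any finite superset may serve as index set. This is how
  sums over different diagrams are compared on common ground.\<close>

lemma rsum_eq_sum:
  assumes "finite K" "{s. (s \<in> S) \<noteq> (s < 0)} \<subseteq> K"
  shows "rsum g S = (\<Sum>s\<in>K. g s * (of_bool (s \<in> S) - of_bool (s < 0)))"
  unfolding rsum_def using assms by (intro sum.mono_neutral_left) auto

lemma rsum_add: "rsum (\<lambda>s. f s + g s) S = rsum f S + rsum g S"
  by (simp add: rsum_def distrib_right sum.distrib)

lemma rsum_cmult: "rsum (\<lambda>s. a * g s) S = a * rsum g S"
  by (simp add: rsum_def sum_distrib_left mult.assoc)

lemma rsum_const: "rsum (\<lambda>_. a) S = a * charge S"
  using rsum_cmult[of a "\<lambda>_. 1" S] by simp

section \<open>Translations and their effect on charge and energy\<close>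

definition shift :: "int \<Rightarrow> int set \<Rightarrow> int set" where
  "shift k S = {s. s - k \<in> S}"

lemma shift_0 [simp]: "shift 0 S = S"
  by (simp add: shift_def)

lemma shift_shift: "shift a (shift b S) = shift (a + b) S"
  by (auto simp: shift_def algebra_simps)

lemma maya_shift:
  assumes "maya S"
  shows "maya (shift k S)"
proof -
  \<comment> \<open>The support moves along with the diagram, except where \<open>s\<close> and
    \<open>s - k\<close> have different signs; such \<open>s\<close> lie within
    \<open>\<bar>k\<bar>\<close> of 0.\<close>
  have "{s. (s \<in> shift k S) \<noteq> (s < 0)} \<subseteq> (\<lambda>s. s + k) ` {s. (s \<in> S) \<noteq> (s < 0)} \<union> {-\<bar>k\<bar>..\<bar>k\<bar>}"
  proof
    fix s assume s: "s \<in> {s. (s \<in> shift k S) \<noteq> (s < 0)}"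
    show "s \<in> (\<lambda>s. s + k) ` {s. (s \<in> S) \<noteq> (s < 0)} \<union> {-\<bar>k\<bar>..\<bar>k\<bar>}"
    proof (cases "(s - k < 0) = (s < 0)")
      case True
      then have "s = (s - k) + k" "s - k \<in> {s. (s \<in> S) \<noteq> (s < 0)}"
        using s by (auto simp: shift_def)
      then show ?thesis by blast
    next
      case False
      then show ?thesis by auto
    qed
  qed
  then show ?thesis
    unfolding maya_def by (rule finite_subset) (use assms in \<open>auto simp: maya_def\<close>)
qed

text \<open>The vacuum does not move with the diagram: its top element -1 is carried to 0, which now
  counts as a particle and contributes \<open>g 0\<close>. The index set contains -1 so that this
  correction is visible in the sum.\<close>

lemma rsum_shift_1:
  assumes "maya S"
  shows "rsum g (shift 1 S) = rsum (\<lambda>s. g (s + 1)) S + g 0"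
proof -
  define K where "K = insert (-1) {s. (s \<in> S) \<noteq> (s < 0)}"
  have K: "finite K" "-1 \<in> K" "{s. (s \<in> S) \<noteq> (s < 0)} \<subseteq> K"
    using assms by (auto simp: K_def maya_def)
  have sub: "{s. (s \<in> shift 1 S) \<noteq> (s < 0)} \<subseteq> (\<lambda>s. s + 1) ` K"
  proof
    fix s :: int assume "s \<in> {s. (s \<in> shift 1 S) \<noteq> (s < 0)}"
    then have "s - 1 \<in> K" by (auto simp: K_def shift_def)
    then show "s \<in> (\<lambda>s. s + 1) ` K" by force
  qed
  have "rsum g (shift 1 S) = (\<Sum>s\<in>(\<lambda>s. s + 1) ` K. g s * (of_bool (s \<in> shift 1 S) - of_bool (s < 0)))"
    using K sub by (intro rsum_eq_sum) auto
  also have "\<dots> = (\<Sum>s\<in>K. g (s + 1) * (of_bool (s \<in> S) - of_bool (s + 1 < 0)))"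
    by (subst sum.reindex) (auto simp: shift_def inj_on_def)
  also have "\<dots> = (\<Sum>s\<in>K. g (s + 1) * (of_bool (s \<in> S) - of_bool (s < 0)) + (if s = -1 then g 0 else 0))"
    by (intro sum.cong) auto
  also have "\<dots> = rsum (\<lambda>s. g (s + 1)) S + g 0"
    using K by (simp add: sum.distrib rsum_eq_sum[OF K(1,3)])
  finally show ?thesis .
qed

lemma charge_shift:
  assumes "maya S"
  shows "charge (shift k S) = charge S + k"
proof (induction k rule: int_induct[where k = 0])
  case (step1 i)
  then show ?case
    using rsum_shift_1[OF maya_shift[OF assms], of "\<lambda>_. 1" i] by (simp add: shift_shift add.commute)
next
  case (step2 i)
  then show ?case
    using rsum_shift_1[OF maya_shift[OF assms], of "\<lambda>_. 1" "i - 1"] by (simp add: shift_shift)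
qed simp

text \<open>A unit translation raises the energy by the current charge, and the charge grows by one
  each time, so a triangular number accumulates. Doubling avoids the division by 2.\<close>

lemma energy_shift:
  assumes "maya S"
  shows "2 * energy (shift k S) = 2 * energy S + 2 * k * charge S + k * (k - 1)"
proof (induction k rule: int_induct[where k = 0])
  case (step1 i)
  then show ?case
    using rsum_shift_1[OF maya_shift[OF assms], of "\<lambda>s. s" i] charge_shift[OF assms, of i]
    by (simp add: shift_shift rsum_add algebra_simps)
next
  case (step2 i)
  then show ?case
    using rsum_shift_1[OF maya_shift[OF assms], of "\<lambda>s. s" "i - 1"] charge_shift[OF assms, of "i - 1"]
    by (simp add: shift_shift rsum_add algebra_simps)
qed simp

section \<open>Runners of the \<open>k\<close>-abacus: splitting a diagram by residues\<close>

definition runner :: "int \<Rightarrow> int \<Rightarrow> int set \<Rightarrow> int set" where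
  "runner k j S = {l. k * l + j \<in> S}"

text \<open>The third claim makes the vacuum restrict to the vacuum on every runner, so particles
  and holes of \<open>S\<close> are those of its runners.\<close>

lemma div_mod_runner_index:
  fixes k j l :: int
  assumes "j \<in> {0..<k}"
  shows "(k * l + j) div k = l" "(k * l + j) mod k = j" "k * l + j < 0 \<longleftrightarrow> l < 0"
proof -
  show d: "(k * l + j) div k = l" and "(k * l + j) mod k = j"
    using assms by auto
  have "0 < k" using assms by auto
  from pos_imp_zdiv_neg_iff[OF this, of "k * l + j"] d show "k * l + j < 0 \<longleftrightarrow> l < 0"
    by simp
qed

lemma maya_runner:
  assumes "maya S" "j \<in> {0..<k}"
  shows "maya (runner k j S)"
proof -
  have "(\<lambda>l. k * l + j) ` {l. (l \<in> runner k j S) \<noteq> (l < 0)} \<subseteq> {s. (s \<in> S) \<noteq> (s < 0)}"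
    using div_mod_runner_index(3)[OF assms(2)] by (fastforce simp: runner_def)
  then have "finite ((\<lambda>l. k * l + j) ` {l. (l \<in> runner k j S) \<noteq> (l < 0)})"
    using assms(1) unfolding maya_def by (rule finite_subset)
  moreover have "inj_on (\<lambda>l. k * l + j) {l. (l \<in> runner k j S) \<noteq> (l < 0)}"
    using assms(2) by (auto simp: inj_on_def)
  ultimately show ?thesis
    unfolding maya_def by (rule finite_imageD)
qed

lemma rsum_runners:
  assumes "maya S" "0 < k"
  shows "rsum g S = (\<Sum>j=0..<k. rsum (\<lambda>l. g (k * l + j)) (runner k j S))"
proof -
  \<comment> \<open>All levels at which \<open>S\<close> differs from the vacuum: one finite index
    set that serves all runners at once.\<close>
  define L where "L = (\<lambda>s. s div k) ` {s. (s \<in> S) \<noteq> (s < 0)}"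
  have L: "finite L" using assms by (simp add: L_def maya_def)
  have cover: "{s. (s \<in> S) \<noteq> (s < 0)} \<subseteq> (\<lambda>(j, l). k * l + j) ` ({0..<k} \<times> L)"
  proof
    fix s assume "s \<in> {s. (s \<in> S) \<noteq> (s < 0)}"
    then have "s div k \<in> L" by (auto simp: L_def)
    moreover have "s mod k \<in> {0..<k}" using assms by auto
    moreover have "s = k * (s div k) + s mod k" by simp
    ultimately show "s \<in> (\<lambda>(j, l). k * l + j) ` ({0..<k} \<times> L)"
      by (intro image_eqI[of _ _ "(s mod k, s div k)"]) auto
  qed
  have inj: "inj_on (\<lambda>(j, l). k * l + j) ({0..<k} \<times> L)"
  proof (rule inj_onI, clarify)
    fix j l j' l' assume "j \<in> {0..<k}" "j' \<in> {0..<k}" "k * l + j = k * l' + j'"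
    then show "j = j' \<and> l = l'"
      by (metis div_mod_runner_index(1,2))
  qed
  have "rsum g S = (\<Sum>s\<in>(\<lambda>(j, l). k * l + j) ` ({0..<k} \<times> L). g s * (of_bool (s \<in> S) - of_bool (s < 0)))"
    using L cover by (intro rsum_eq_sum) auto
  also have "\<dots> = (\<Sum>j=0..<k. \<Sum>l\<in>L. g (k * l + j) * (of_bool (k * l + j \<in> S) - of_bool (k * l + j < 0)))"
    by (subst sum.reindex[OF inj]) (simp add: sum.cartesian_product case_prod_unfold)
  also have "\<dots> = (\<Sum>j=0..<k. rsum (\<lambda>l. g (k * l + j)) (runner k j S))"
  proof (rule sum.cong)
    fix j assume j: "j \<in> {0..<k}"
    have "{l. (l \<in> runner k j S) \<noteq> (l < 0)} \<subseteq> L"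
    proof
      fix l assume "l \<in> {l. (l \<in> runner k j S) \<noteq> (l < 0)}"
      then have "k * l + j \<in> {s. (s \<in> S) \<noteq> (s < 0)}"
        using div_mod_runner_index(3)[OF j, of l] by (simp add: runner_def)
      then show "l \<in> L"
        unfolding L_def by (rule rev_image_eqI) (rule div_mod_runner_index(1)[OF j, symmetric])
    qed
    from rsum_eq_sum[OF L this, of "\<lambda>l. g (k * l + j)"]
    show "(\<Sum>l\<in>L. g (k * l + j) * (of_bool (k * l + j \<in> S) - of_bool (k * l + j < 0))) =
        rsum (\<lambda>l. g (k * l + j)) (runner k j S)"
      unfolding runner_def mem_Collect_eq div_mod_runner_index(3)[OF j] by (rule sym)
  qed simp
  finally show ?thesis .
qed

lemma maya_if_runners:
  assumes "0 < k" "\<And>j. j \<in> {0..<k} \<Longrightarrow> maya (runner k j S)"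
  shows "maya S"
proof -
  have "{s. (s \<in> S) \<noteq> (s < 0)} \<subseteq>
      (\<Union>j\<in>{0..<k}. (\<lambda>l. k * l + j) ` {l. (l \<in> runner k j S) \<noteq> (l < 0)})"
  proof
    fix s assume s: "s \<in> {s. (s \<in> S) \<noteq> (s < 0)}"
    have j: "s mod k \<in> {0..<k}" using assms by auto
    have eq: "s = k * (s div k) + s mod k" by simp
    have "s div k \<in> {l. (l \<in> runner k (s mod k) S) \<noteq> (l < 0)}"
      using s div_mod_runner_index(3)[OF j, of "s div k"] by (simp add: runner_def)
    with eq j show "s \<in> (\<Union>j\<in>{0..<k}. (\<lambda>l. k * l + j) ` {l. (l \<in> runner k j S) \<noteq> (l < 0)})"
      by blast
  qed
  moreover have "finite (\<Union>j\<in>{0..<k}. (\<lambda>l. k * l + j) ` {l. (l \<in> runner k j S) \<noteq> (l < 0)})"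
    using assms by (auto simp: maya_def)
  ultimately show ?thesis
    unfolding maya_def by (rule finite_subset)
qed

section \<open>An isometry between two cosets in the root lattice\<close>

lemma atLeastLessThan_11: "{0..<11::int} = {0,1,2,3,4,5,6,7,8,9,10}"
  by (simp add: set_eq_iff, presburger)

text \<open>Apart from the entry 11, this is the residue of \<open>i * (j - 5)\<close> modulo 11
  in \<open>{- 4..6}\<close>: those residues have sum 11 and square sum 121, as the rows of 11 times
  an orthogonal matrix fixing the all-ones vector must.\<close>

definition gluing :: "int \<Rightarrow> int \<Rightarrow> int" where
  "gluing i j = (if i = 0 \<and> j = 5 then 11 else (i * (j - 5) + 4) mod 11 - 4)"

text \<open>The exceptional entry 11 stands where the product \<open>i * (j - 5)\<close> is 0, so it
  obeys the congruence too.\<close>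

lemma gluing_cong: "gluing i j mod 11 = i * (j - 5) mod 11"
  by (simp add: gluing_def mod_simps)

lemma gluing_row_orthogonal:
  assumes "i \<in> {0..<11}" "k \<in> {0..<11}"
  shows "(\<Sum>j=0..<11. gluing i j * gluing k j) = (if i = k then 121 else 0)"
  using assms unfolding atLeastLessThan_11
  by (elim insertE emptyE; simp add: gluing_def)

lemma gluing_column_orthogonal:
  assumes "j \<in> {0..<11}" "k \<in> {0..<11}"
  shows "(\<Sum>i=0..<11. gluing i j * gluing i k) = (if j = k then 121 else 0)"
  using assms unfolding atLeastLessThan_11
  by (elim insertE emptyE; simp add: gluing_def)

lemma gluing_row_sum:
  assumes "i \<in> {0..<11}"
  shows "(\<Sum>j=0..<11. gluing i j) = 11"
  using assms unfolding atLeastLessThan_11 by (elim insertE emptyE; simp add: gluing_def)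

lemma gluing_column_sum:
  assumes "j \<in> {0..<11}"
  shows "(\<Sum>i=0..<11. gluing i j) = 11"
  using assms unfolding atLeastLessThan_11 by (elim insertE emptyE; simp add: gluing_def)

text \<open>Precision 121 is required because \<open>unglue\<close> divides by 121.\<close>

lemma gluing_row_moment:
  assumes "i \<in> {0..<11}"
  shows "(\<Sum>j=0..<11. gluing i j * (j - 5)) mod 121 = 55 * i mod 121"
  using assms unfolding atLeastLessThan_11 by (elim insertE emptyE; simp add: gluing_def)

text \<open>The value is 11 times the residue of \<open>j - 5\<close> in \<open>{0..10}\<close>. It
  is exact, since \<open>moment_unglue\<close> divides by 121 before reducing modulo 11.\<close>

lemma gluing_column_moment:
  assumes "j \<in> {0..<11}"
  shows "(\<Sum>i=0..<11. i * gluing i j) = 11 * ((j - 5) + 11 * of_bool (j < 5))"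
  using assms unfolding atLeastLessThan_11 by (elim insertE emptyE; simp add: gluing_def)

lemma sum_mod_cong:
  fixes f g :: "'a \<Rightarrow> int"
  assumes "\<And>x. x \<in> A \<Longrightarrow> f x mod n = g x mod n"
  shows "sum f A mod n = sum g A mod n"
  by (metis (no_types, lifting) assms mod_sum_eq sum.cong)

text \<open>Multiplication of the row vector \<open>c\<close> by the matrix yields a vector of the
  form \<open>11 * c' j + (j - 5)\<close>; the new charges are the \<open>c' j\<close>.\<close>

definition glue :: "(int \<Rightarrow> int) \<Rightarrow> int \<Rightarrow> int" where
  "glue c j = ((\<Sum>i=0..<11. c i * gluing i j) - (j - 5)) div 11"

text \<open>The inverse of \<open>glue\<close>: by orthogonality, the matrix product with its
  transpose is 121 times the identity.\<close>

definition unglue :: "(int \<Rightarrow> int) \<Rightarrow> int \<Rightarrow> int" where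
  "unglue c i = (\<Sum>j=0..<11. gluing i j * (11 * c j + (j - 5))) div 121"

text \<open>Modulo 11 the matrix entries factor as \<open>i * (j - 5)\<close>, so the product is
  \<open>j - 5\<close> times the moment of \<open>c\<close>, which is 1. Hence the division in
  \<open>glue\<close> is exact.\<close>

lemma glue_eq:
  assumes "(\<Sum>i=0..<11. i * c i) mod 11 = 1"
  shows "11 * glue c j + (j - 5) = (\<Sum>i=0..<11. c i * gluing i j)"
proof -
  have "(\<Sum>i=0..<11. c i * gluing i j) mod 11 = (\<Sum>i=0..<11. i * c i * (j - 5)) mod 11"
    by (rule sum_mod_cong) (metis gluing_cong mod_mult_right_eq mult.assoc mult.commute)
  also have "\<dots> = (j - 5) mod 11"
    by (metis assms mod_mult_left_eq mult_1 sum_distrib_right)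
  finally have "11 dvd (\<Sum>i=0..<11. c i * gluing i j) - (j - 5)"
    by (simp add: mod_eq_dvd_iff)
  then show ?thesis by (simp add: glue_def)
qed

text \<open>Exactness of the division by 121. The residue 6 is -5, the moment that energy
  \<open>11 * n - 5\<close> forces; modulo 121 the two parts of the sum are
  \<open>11 * 6 * i\<close> and \<open>55 * i\<close>, which add up to
  \<open>121 * i\<close>.\<close>

lemma unglue_eq:
  assumes "sum c {0..<11} = 0" "(\<Sum>j=0..<11. j * c j) mod 11 = 6" "i \<in> {0..<11}"
  shows "121 * unglue c i = (\<Sum>j=0..<11. gluing i j * (11 * c j + (j - 5)))"
proof -
  have "(\<Sum>j=0..<11. gluing i j * c j) mod 11 = (\<Sum>j=0..<11. i * (j * c j) - 5 * i * c j) mod 11"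
  proof (rule sum_mod_cong)
    fix j
    have "gluing i j * c j mod 11 = i * (j - 5) * c j mod 11"
      by (metis gluing_cong mod_mult_left_eq)
    then show "gluing i j * c j mod 11 = (i * (j * c j) - 5 * i * c j) mod 11"
      by (simp add: algebra_simps)
  qed
  also have "(\<Sum>j=0..<11. i * (j * c j) - 5 * i * c j) = i * (\<Sum>j=0..<11. j * c j)"
    using assms(1) by (simp add: sum_subtractf flip: sum_distrib_left)
  also have "\<dots> mod 11 = i * 6 mod 11"
    by (metis assms(2) mod_mult_right_eq)
  finally obtain a where a: "(\<Sum>j=0..<11. gluing i j * c j) = i * 6 + 11 * a"
    by (elim mod_eqE[OF sym])
  obtain b where b: "(\<Sum>j=0..<11. gluing i j * (j - 5)) = 55 * i + 121 * b"
    by (rule mod_eqE[OF gluing_row_moment[OF assms(3), symmetric]])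
  have "(\<Sum>j=0..<11. gluing i j * (11 * c j + (j - 5))) =
      11 * (\<Sum>j=0..<11. gluing i j * c j) + (\<Sum>j=0..<11. gluing i j * (j - 5))"
    by (simp add: distrib_left sum.distrib sum_distrib_left mult.left_commute)
  also have "\<dots> = 121 * (i + a + b)"
    by (simp add: a b)
  finally show ?thesis by (simp add: unglue_def)
qed

lemma sum_centred_11: "(\<Sum>j=0..<11. j - 5) = (0::int)"
  by (simp add: atLeastLessThan_11)

text \<open>Constant row sums preserve total charge zero, and the offsets \<open>j - 5\<close> are
  centred, so they contribute nothing.\<close>

lemma sum_glue:
  assumes "sum c {0..<11} = 0" "(\<Sum>i=0..<11. i * c i) mod 11 = 1"
  shows "sum (glue c) {0..<11} = 0"
proof -
  have "11 * sum (glue c) {0..<11} = (\<Sum>j=0..<11. 11 * glue c j + (j - 5))"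
    by (simp only: sum.distrib sum_centred_11 sum_distrib_left add_0_right)
  also have "\<dots> = (\<Sum>i=0..<11. \<Sum>j=0..<11. c i * gluing i j)"
    unfolding glue_eq[OF assms(2)] by (rule sum.swap)
  also have "\<dots> = (\<Sum>i=0..<11. c i * 11)"
    by (intro sum.cong) (simp_all add: gluing_row_sum flip: sum_distrib_left)
  also have "\<dots> = 0"
    using assms(1) by (simp flip: sum_distrib_right)
  finally show ?thesis by simp
qed

lemma norm_glue_raw:
  "(\<Sum>j=0..<11. (\<Sum>i=0..<11. c i * gluing i j)\<^sup>2) = 121 * (\<Sum>i=0..<11. (c i)\<^sup>2)"
proof -
  have "(\<Sum>j=0..<11. (\<Sum>i=0..<11. c i * gluing i j)\<^sup>2) =
      (\<Sum>j=0..<11. \<Sum>i=0..<11. \<Sum>k=0..<11. c i * c k * (gluing i j * gluing k j))"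
    by (simp add: power2_eq_square sum_product mult_ac)
  also have "\<dots> = (\<Sum>i=0..<11. \<Sum>j=0..<11. \<Sum>k=0..<11. c i * c k * (gluing i j * gluing k j))"
    by (rule sum.swap)
  also have "\<dots> = (\<Sum>i=0..<11. \<Sum>k=0..<11. \<Sum>j=0..<11. c i * c k * (gluing i j * gluing k j))"
    by (intro sum.cong refl sum.swap)
  also have "\<dots> = (\<Sum>i=0..<11. \<Sum>k=0..<11. c i * c k * (if i = k then 121 else 0))"
    by (intro sum.cong refl) (simp only: gluing_row_orthogonal flip: sum_distrib_left)
  also have "\<dots> = (\<Sum>i=0..<11. 121 * (c i)\<^sup>2)"
    by (intro sum.cong refl) (simp add: if_distrib sum.delta power2_eq_square cong: if_cong)
  finally show ?thesis by (simp add: sum_distrib_left)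
qed

text \<open>The isometry rewritten in charges. The 10 is the square sum 110 of the offsets divided
  by 11; half of it becomes the 5 in \<open>11 * n - 5\<close>.\<close>

lemma norm_glue:
  assumes "sum c {0..<11} = 0" "(\<Sum>i=0..<11. i * c i) mod 11 = 1"
  shows "11 * (\<Sum>j=0..<11. (glue c j)\<^sup>2) + 2 * (\<Sum>j=0..<11. j * glue c j) + 10
    = 11 * (\<Sum>i=0..<11. (c i)\<^sup>2)"
proof -
  have "121 * (\<Sum>i=0..<11. (c i)\<^sup>2) = (\<Sum>j=0..<11. (11 * glue c j + (j - 5))\<^sup>2)"
    using norm_glue_raw[of c] glue_eq[OF assms(2)] by simp
  also have "\<dots> = (\<Sum>j=0..<11. 121 * (glue c j)\<^sup>2 + 22 * (j * glue c j) - 110 * glue c j + (j - 5)\<^sup>2)"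
    by (intro sum.cong refl) (simp add: power2_eq_square algebra_simps)
  also have "\<dots> = 121 * (\<Sum>j=0..<11. (glue c j)\<^sup>2) + 22 * (\<Sum>j=0..<11. j * glue c j)
      - 110 * sum (glue c) {0..<11} + (\<Sum>j=0..<11. (j - 5)\<^sup>2)"
    by (simp only: sum.distrib sum_subtractf sum_distrib_left)
  also have "(\<Sum>j=0..<11. (j - 5)\<^sup>2) = (110::int)"
    by (simp add: atLeastLessThan_11)
  finally show ?thesis
    using sum_glue[OF assms] by simp
qed

lemma unglue_glue:
  assumes "(\<Sum>i=0..<11. i * c i) mod 11 = 1" "i \<in> {0..<11}"
  shows "unglue (glue c) i = c i"
proof -
  have "(\<Sum>j=0..<11. gluing i j * (11 * glue c j + (j - 5))) =
      (\<Sum>j=0..<11. \<Sum>k=0..<11. c k * (gluing i j * gluing k j))"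
    unfolding glue_eq[OF assms(1)] by (simp add: sum_distrib_left mult_ac)
  also have "\<dots> = (\<Sum>k=0..<11. \<Sum>j=0..<11. c k * (gluing i j * gluing k j))"
    by (rule sum.swap)
  also have "\<dots> = (\<Sum>k=0..<11. c k * (if i = k then 121 else 0))"
    by (intro sum.cong refl) (simp only: gluing_row_orthogonal[OF assms(2)] flip: sum_distrib_left)
  also have "\<dots> = 121 * c i"
    using assms(2) by (simp add: if_distrib sum.delta cong: if_cong)
  finally show ?thesis by (simp add: unglue_def)
qed

lemma glue_unglue:
  assumes "sum c {0..<11} = 0" "(\<Sum>j=0..<11. j * c j) mod 11 = 6" "j \<in> {0..<11}"
  shows "glue (unglue c) j = c j"
proof -
  have "121 * (\<Sum>i=0..<11. unglue c i * gluing i j) = (\<Sum>i=0..<11. (121 * unglue c i) * gluing i j)"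
    by (simp add: sum_distrib_left mult.assoc)
  also have "\<dots> = (\<Sum>i=0..<11. \<Sum>k=0..<11. (11 * c k + (k - 5)) * (gluing i j * gluing i k))"
    by (intro sum.cong refl, subst unglue_eq[OF assms(1,2)])
      (simp_all add: sum_distrib_left sum_distrib_right mult_ac)
  also have "\<dots> = (\<Sum>k=0..<11. \<Sum>i=0..<11. (11 * c k + (k - 5)) * (gluing i j * gluing i k))"
    by (rule sum.swap)
  also have "\<dots> = (\<Sum>k=0..<11. (11 * c k + (k - 5)) * (if j = k then 121 else 0))"
    by (intro sum.cong refl) (simp only: gluing_column_orthogonal[OF assms(3)] flip: sum_distrib_left)
  also have "\<dots> = 121 * (11 * c j + (j - 5))"
    using assms(3) by (simp add: if_distrib sum.delta cong: if_cong)
  finally show ?thesis by (simp add: glue_def)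
qed

lemma sum_unglue:
  assumes "sum c {0..<11} = 0" "(\<Sum>j=0..<11. j * c j) mod 11 = 6"
  shows "sum (unglue c) {0..<11} = 0"
proof -
  have "121 * sum (unglue c) {0..<11} = (\<Sum>i=0..<11. \<Sum>j=0..<11. gluing i j * (11 * c j + (j - 5)))"
    unfolding sum_distrib_left by (intro sum.cong refl) (rule unglue_eq[OF assms])
  also have "\<dots> = (\<Sum>j=0..<11. \<Sum>i=0..<11. gluing i j * (11 * c j + (j - 5)))"
    by (rule sum.swap)
  also have "\<dots> = (\<Sum>j=0..<11. 11 * (11 * c j + (j - 5)))"
    by (intro sum.cong refl) (simp add: gluing_column_sum flip: sum_distrib_right)
  also have "\<dots> = 11 * (11 * sum c {0..<11} + (\<Sum>j=0..<11. j - 5))"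
    by (simp only: sum_distrib_left sum.distrib distrib_left)
  finally show ?thesis
    by (simp only: assms(1) sum_centred_11) simp
qed

lemma moment_unglue:
  assumes "sum c {0..<11} = 0" "(\<Sum>j=0..<11. j * c j) mod 11 = 6"
  shows "(\<Sum>i=0..<11. i * unglue c i) mod 11 = 1"
proof -
  have "121 * (\<Sum>i=0..<11. i * unglue c i) = (\<Sum>i=0..<11. i * (121 * unglue c i))"
    by (simp add: sum_distrib_left mult_ac)
  also have "\<dots> = (\<Sum>i=0..<11. \<Sum>j=0..<11. (i * gluing i j) * (11 * c j + (j - 5)))"
    by (intro sum.cong refl) (simp add: unglue_eq[OF assms] sum_distrib_left mult.assoc)
  also have "\<dots> = (\<Sum>j=0..<11. \<Sum>i=0..<11. (i * gluing i j) * (11 * c j + (j - 5)))"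
    by (rule sum.swap)
  also have "\<dots> = (\<Sum>j=0..<11. 11 * ((j - 5) + 11 * of_bool (j < 5)) * (11 * c j + (j - 5)))"
    by (intro sum.cong refl) (simp only: gluing_column_moment flip: sum_distrib_right)
  also have "\<dots> = (\<Sum>j=0..<11. 121 * (j * c j) - 605 * c j + 11 * (j - 5)\<^sup>2 +
      1331 * (of_bool (j < 5) * c j) + 121 * (of_bool (j < 5) * (j - 5)))"
    by (intro sum.cong refl) (simp add: power2_eq_square algebra_simps)
  also have "\<dots> = 121 * (\<Sum>j=0..<11. j * c j) - 605 * sum c {0..<11} + 11 * (\<Sum>j=0..<11. (j - 5)\<^sup>2) +
      1331 * (\<Sum>j=0..<11. of_bool (j < 5) * c j) + 121 * (\<Sum>j=0..<11. of_bool (j < 5) * (j - 5))"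
    by (simp only: sum.distrib sum_subtractf sum_distrib_left)
  also have "(\<Sum>j=0..<11. (j - 5)\<^sup>2) = (110::int)"
    by (simp add: atLeastLessThan_11)
  also have "(\<Sum>j=0..<11. of_bool (j < 5) * (j - 5)) = (-15::int)"
    by (simp add: atLeastLessThan_11)
  \<comment> \<open>After division by 121 the constants \<open>11 * 110\<close> and
    \<open>121 * (-15)\<close> become 10 and -15, which leaves -5; then 6 - 5 = 1.\<close>
  finally have "(\<Sum>i=0..<11. i * unglue c i) =
      (\<Sum>j=0..<11. j * c j) - 5 + 11 * (\<Sum>j=0..<11. of_bool (j < 5) * c j)"
    using assms(1) by simp
  moreover have "(x - 5 + 11 * y) mod 11 = 1" if "x mod 11 = 6" for x y :: int
    using that by presburger
  ultimately show ?thesis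
    using assms(2) by metis
qed

section \<open>Changing the charges\<close>

abbreviation charges :: "int set \<Rightarrow> int \<Rightarrow> int" where
  "charges S j \<equiv> charge (runner 11 j S)"

lemma charge_runners:
  assumes "maya S"
  shows "charge S = sum (charges S) {0..<11}"
  using rsum_runners[OF assms, of 11] by simp

lemma rsum_div_runners:
  assumes "maya S"
  shows "rsum (\<lambda>s. s div 11) S = (\<Sum>j=0..<11. energy (runner 11 j S))"
proof -
  have "rsum (\<lambda>l. (11 * l + j) div 11) (runner 11 j S) = energy (runner 11 j S)"
    if "j \<in> {0..<11}" for j
    by (simp only: div_mod_runner_index(1)[OF that])
  then show ?thesis
    using rsum_runners[OF assms, of 11] by simp
qed

lemma rsum_mod_runners:
  assumes "maya S"
  shows "rsum (\<lambda>s. s mod 11) S = (\<Sum>j=0..<11. j * charges S j)"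
proof -
  have "rsum (\<lambda>l. (11 * l + j) mod 11) (runner 11 j S) = j * charges S j"
    if "j \<in> {0..<11}" for j
    by (simp only: div_mod_runner_index(2)[OF that] rsum_const[of j])
  then show ?thesis
    using rsum_runners[OF assms, of 11] by simp
qed

lemma energy_div_mod: "energy S = k * rsum (\<lambda>s. s div k) S + rsum (\<lambda>s. s mod k) S"
proof -
  have "energy S = rsum (\<lambda>s. k * (s div k) + s mod k) S"
    by simp
  then show ?thesis
    by (simp only: rsum_add rsum_cmult)
qed

text \<open>The runner of residue \<open>j\<close> is translated by \<open>d j\<close>: the
  uncharged diagram on each runner is kept and only the charges change.\<close>

definition recharge :: "(int \<Rightarrow> int) \<Rightarrow> int set \<Rightarrow> int set" where
  "recharge d S = {s. s - 11 * d (s mod 11) \<in> S}"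

lemma runner_recharge:
  assumes "j \<in> {0..<11}"
  shows "runner 11 j (recharge d S) = shift (d j) (runner 11 j S)"
  using div_mod_runner_index(2)[OF assms]
  by (simp add: runner_def recharge_def shift_def algebra_simps)

lemma maya_recharge:
  assumes "maya S"
  shows "maya (recharge d S)"
proof (rule maya_if_runners)
  show "maya (runner 11 j (recharge d S))" if "j \<in> {0..<11}" for j
    unfolding runner_recharge[OF that] by (rule maya_shift[OF maya_runner[OF assms that]])
qed simp

lemma charges_recharge:
  assumes "maya S" "j \<in> {0..<11}"
  shows "charges (recharge d S) j = charges S j + d j"
  by (simp only: runner_recharge[OF assms(2)] charge_shift[OF maya_runner[OF assms]])

lemma recharge_recharge: "recharge d (recharge e S) = recharge (\<lambda>j. d j + e j) S"
proof -
  have "(s - 11 * d (s mod 11)) mod 11 = s mod 11" for s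
    by (simp add: mod_diff_eq flip: mod_diff_right_eq)
  then show ?thesis by (simp add: recharge_def algebra_simps)
qed

lemma recharge_cong:
  assumes "\<And>j. j \<in> {0..<11} \<Longrightarrow> d j = e j"
  shows "recharge d S = recharge e S"
proof -
  have "d (s mod 11) = e (s mod 11)" for s
    by (rule assms) simp
  then show ?thesis by (simp add: recharge_def)
qed

lemma recharge_zero: "recharge (\<lambda>_. 0) S = S"
  by (simp add: recharge_def)

text \<open>On a single runner, twice the energy minus the square of the charge plus the charge is
  invariant under translation. Summed over the runners, the linear part is unchanged because the
  \<open>d j\<close> add up to 0.\<close>

lemma rsum_div_recharge:
  assumes "maya S" "charge S = 0" "sum d {0..<11} = 0"
  shows "2 * rsum (\<lambda>s. s div 11) (recharge d S) - (\<Sum>j=0..<11. (charges (recharge d S) j)\<^sup>2) =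
    2 * rsum (\<lambda>s. s div 11) S - (\<Sum>j=0..<11. (charges S j)\<^sup>2)"
proof -
  have *: "2 * energy (runner 11 j (recharge d S)) - (charges (recharge d S) j)\<^sup>2
      = 2 * energy (runner 11 j S) - (charges S j)\<^sup>2 - d j" if "j \<in> {0..<11}" for j
    unfolding runner_recharge[OF that] charge_shift[OF maya_runner[OF assms(1) that]]
      energy_shift[OF maya_runner[OF assms(1) that]]
    by (simp add: power2_eq_square algebra_simps)
  have "(\<Sum>j=0..<11. 2 * energy (runner 11 j (recharge d S)) - (charges (recharge d S) j)\<^sup>2) =
      (\<Sum>j=0..<11. 2 * energy (runner 11 j S) - (charges S j)\<^sup>2 - d j)"
    by (intro sum.cong refl *)
  then show ?thesis
    unfolding rsum_div_runners[OF assms(1)] rsum_div_runners[OF maya_recharge[OF assms(1)]]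
    by (simp only: sum_subtractf sum_distrib_left assms(3) diff_zero)
qed

text \<open>The bijection replaces the charge vector by its image under \<open>glue\<close> and
  leaves the uncharged runners alone; \<open>unglue\<close> gives the inverse.\<close>

lemma card_residue_one_eq:
  "card {S. maya S \<and> charge S = 0 \<and> rsum (\<lambda>s. s div 11) S = n \<and> rsum (\<lambda>s. s mod 11) S mod 11 = 1} =
   card {S. maya S \<and> charge S = 0 \<and> energy S = 11 * n - 5}" (is "card ?A = card ?B")
proof -
  define f where "f S = recharge (\<lambda>j. glue (charges S) j - charges S j) S" for S
  define g where "g S = recharge (\<lambda>j. unglue (charges S) j - charges S j) S" for S
  have A: "f S \<in> ?B \<and> g (f S) = S" if "S \<in> ?A" for S
  proof -
    from that have S: "maya S" "charge S = 0" "rsum (\<lambda>s. s div 11) S = n"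
      and T: "rsum (\<lambda>s. s mod 11) S mod 11 = 1"
      by simp_all
    have c0: "sum (charges S) {0..<11} = 0"
      using S(2) unfolding charge_runners[OF S(1)] .
    have c1: "(\<Sum>j=0..<11. j * charges S j) mod 11 = 1"
      using T unfolding rsum_mod_runners[OF S(1)] .
    have d0: "(\<Sum>j=0..<11. glue (charges S) j - charges S j) = 0"
      by (simp add: sum_subtractf c0 sum_glue[OF c0 c1])
    have ch: "charges (f S) j = glue (charges S) j" if "j \<in> {0..<11}" for j
      unfolding f_def charges_recharge[OF S(1) that] by simp
    have mf: "maya (f S)"
      unfolding f_def by (rule maya_recharge[OF S(1)])
    have chf: "charge (f S) = 0"
      unfolding charge_runners[OF mf] using ch sum_glue[OF c0 c1] by simp
    have "2 * rsum (\<lambda>s. s div 11) (f S) - (\<Sum>j=0..<11. (glue (charges S) j)\<^sup>2) =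
        2 * n - (\<Sum>j=0..<11. (charges S j)\<^sup>2)"
      using rsum_div_recharge[OF S(1,2) d0] ch S(3) by (simp add: f_def)
    moreover have "rsum (\<lambda>s. s mod 11) (f S) = (\<Sum>j=0..<11. j * glue (charges S) j)"
      unfolding rsum_mod_runners[OF mf] using ch by simp
    \<comment> \<open>Eleven times the translation invariant and \<open>norm_glue\<close> have the
      same squares; cancelling them leaves twice the energy equal to
      \<open>22 * n - 10\<close>.\<close>
    ultimately have "energy (f S) = 11 * n - 5"
      using norm_glue[OF c0 c1] energy_div_mod[of "f S" 11] by linarith
    moreover have "g (f S) = S"
    proof -
      have "unglue (charges (f S)) i = charges S i" if "i \<in> {0..<11}" for i
      proof -
        have "unglue (charges (f S)) i = unglue (glue (charges S)) i"
          using ch by (simp add: unglue_def)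
        then show ?thesis using unglue_glue[OF c1 that] by simp
      qed
      then have "g (f S) = recharge (\<lambda>j. charges S j - glue (charges S) j) (f S)"
        unfolding g_def using ch by (intro recharge_cong) simp
      then show ?thesis
        by (simp add: f_def recharge_recharge recharge_zero)
    qed
    ultimately show ?thesis using mf chf by simp
  qed
  have B: "g S \<in> ?A \<and> f (g S) = S" if "S \<in> ?B" for S
  proof -
    from that have S: "maya S" "charge S = 0" "energy S = 11 * n - 5"
      by simp_all
    have c0: "sum (charges S) {0..<11} = 0"
      using S(2) unfolding charge_runners[OF S(1)] .
    define D where "D = rsum (\<lambda>s. s div 11) S"
    have e: "11 * D + (\<Sum>j=0..<11. j * charges S j) = 11 * n - 5"
      using energy_div_mod[of S 11] S by (simp add: rsum_mod_runners D_def)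
    \<comment> \<open>The energy determines the moment modulo 11, which is exactly the condition for
      \<open>unglue\<close> to be integral.\<close>
    then have T: "(\<Sum>j=0..<11. j * charges S j) = 6 + 11 * (n - D - 1)"
      by simp
    have c6: "(\<Sum>j=0..<11. j * charges S j) mod 11 = 6"
      unfolding T by presburger
    have d0: "(\<Sum>j=0..<11. unglue (charges S) j - charges S j) = 0"
      by (simp add: sum_subtractf c0 sum_unglue[OF c0 c6])
    have ch: "charges (g S) j = unglue (charges S) j" if "j \<in> {0..<11}" for j
      unfolding g_def charges_recharge[OF S(1) that] by simp
    have mg: "maya (g S)"
      unfolding g_def by (rule maya_recharge[OF S(1)])
    have chg: "charge (g S) = 0"
      unfolding charge_runners[OF mg] using ch sum_unglue[OF c0 c6] by simp
    have T: "rsum (\<lambda>s. s mod 11) (g S) mod 11 = 1"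
      unfolding rsum_mod_runners[OF mg] using ch moment_unglue[OF c0 c6] by simp
    have gu: "glue (unglue (charges S)) j = charges S j" if "j \<in> {0..<11}" for j
      by (rule glue_unglue[OF c0 c6 that])
    have "2 * rsum (\<lambda>s. s div 11) (g S) - (\<Sum>j=0..<11. (unglue (charges S) j)\<^sup>2) =
        2 * D - (\<Sum>j=0..<11. (charges S j)\<^sup>2)"
      using rsum_div_recharge[OF S(1,2) d0] ch by (simp add: g_def D_def)
    moreover have "11 * (\<Sum>j=0..<11. (charges S j)\<^sup>2) + 2 * (\<Sum>j=0..<11. j * charges S j) + 10
        = 11 * (\<Sum>i=0..<11. (unglue (charges S) i)\<^sup>2)"
      using norm_glue[OF sum_unglue[OF c0 c6] moment_unglue[OF c0 c6]] gu by simp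
    ultimately have "rsum (\<lambda>s. s div 11) (g S) = n"
      using e by linarith
    moreover have "f (g S) = S"
    proof -
      have "glue (charges (g S)) j = charges S j" if "j \<in> {0..<11}" for j
      proof -
        have "glue (charges (g S)) j = glue (unglue (charges S)) j"
          using ch by (simp add: glue_def)
        then show ?thesis using gu[OF that] by simp
      qed
      then have "f (g S) = recharge (\<lambda>j. charges S j - unglue (charges S) j) (g S)"
        unfolding f_def using ch by (intro recharge_cong) simp
      then show ?thesis
        by (simp add: g_def recharge_recharge recharge_zero)
    qed
    ultimately show ?thesis using mg chg T by simp
  qed
  have "bij_betw f ?A ?B"
    by (rule bij_betw_byWitness[where f' = g]; intro ballI image_subsetI)
      (fact A[THEN conjunct2] B[THEN conjunct2] A[THEN conjunct1] B[THEN conjunct1])+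
  then show ?thesis by (rule bij_betw_same_card)
qed

section \<open>Rotating the colours of a level\<close>

lemma rsum_local_change:
  assumes "maya S" "finite K" "\<And>s. s \<notin> K \<Longrightarrow> s \<in> S' \<longleftrightarrow> s \<in> S"
  shows "maya S'"
    and "rsum g S' = rsum g S + (\<Sum>s\<in>K. g s * (of_bool (s \<in> S') - of_bool (s \<in> S)))"
proof -
  define L where "L = K \<union> {s. (s \<in> S) \<noteq> (s < 0)}"
  have L: "finite L" "{s. (s \<in> S) \<noteq> (s < 0)} \<subseteq> L" "{s. (s \<in> S') \<noteq> (s < 0)} \<subseteq> L"
    using assms by (auto simp: L_def maya_def)
  then show "maya S'"
    unfolding maya_def by (metis finite_subset)
  have "(\<Sum>s\<in>K. g s * (of_bool (s \<in> S') - of_bool (s \<in> S))) =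
      (\<Sum>s\<in>L. g s * (of_bool (s \<in> S') - of_bool (s \<in> S)))"
    using L(1) assms(3) by (intro sum.mono_neutral_left) (auto simp: L_def)
  also have "\<dots> = rsum g S' - rsum g S"
    unfolding rsum_eq_sum[OF L(1,2)] rsum_eq_sum[OF L(1,3)] sum_subtractf[symmetric]
    by (intro sum.cong refl) (simp add: right_diff_distrib)
  finally show "rsum g S' = rsum g S + (\<Sum>s\<in>K. g s * (of_bool (s \<in> S') - of_bool (s \<in> S)))"
    by simp
qed

definition level :: "int set \<Rightarrow> int \<Rightarrow> int set" where
  "level S l = {j \<in> {0..<11}. 11 * l + j \<in> S}"

definition mixed :: "int set \<Rightarrow> int set" where
  "mixed S = {l. level S l \<noteq> {} \<and> level S l \<noteq> {0..<11}}"

text \<open>Membership is tested after rotating back, so an occupied colour \<open>j\<close> of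
  level \<open>l\<close> moves forward to \<open>j + e\<close> modulo 11.\<close>

definition rotate_level :: "int \<Rightarrow> int \<Rightarrow> int set \<Rightarrow> int set" where
  "rotate_level e l S = {s. (if s div 11 = l then 11 * l + (s - e) mod 11 else s) \<in> S}"

lemma mod_11_level: "(11 * l + x - e) mod 11 = (x - e) mod (11::int)"
  by (simp add: add_diff_eq[symmetric])

lemma eq_if_dvd_11_diff:
  fixes i j :: int
  assumes "i \<in> {0..<11}" "j \<in> {0..<11}" "11 dvd i - j"
  shows "i = j"
proof -
  from assms(3) obtain k where "i - j = 11 * k" ..
  then show ?thesis using assms(1,2) by simp presburger
qed

lemma rotate_rotate_level: "rotate_level a l (rotate_level b l S) = rotate_level (a + b) l S"
proof -
  have *: "(11 * l + x mod 11) div 11 = l" for x :: int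
    by simp
  have "(11 * l + (s - a) mod 11 - b) mod 11 = (s - (a + b)) mod 11" for s
    by (simp only: mod_11_level mod_diff_left_eq diff_diff_eq)
  then show ?thesis
    by (auto simp: rotate_level_def *)
qed

lemma rotate_level_0: "rotate_level 0 l S = S"
proof -
  have "(if s div 11 = l then 11 * l + (s - 0) mod 11 else s) = s" for s :: int
    by auto
  then show ?thesis
    by (simp only: rotate_level_def Collect_mem_eq)
qed

lemma level_rotate_level:
  "level (rotate_level e l S) l' = (if l' = l then (\<lambda>j. (j + e) mod 11) ` level S l else level S l')"
proof (cases "l' = l")
  case True
  have "j \<in> level (rotate_level e l S) l \<longleftrightarrow> j \<in> (\<lambda>j. (j + e) mod 11) ` level S l" for j
  proof
    assume "j \<in> level (rotate_level e l S) l"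
    then have j: "0 \<le> j" "j < 11" and "11 * l + (11 * l + j - e) mod 11 \<in> S"
      by (auto simp: level_def rotate_level_def div_pos_pos_trivial)
    then have "(j - e) mod 11 \<in> level S l"
      by (simp add: level_def mod_11_level)
    moreover have "j = ((j - e) mod 11 + e) mod 11"
      using j by (simp only: mod_add_left_eq diff_add_cancel mod_pos_pos_trivial)
    ultimately show "j \<in> (\<lambda>j. (j + e) mod 11) ` level S l"
      by blast
  next
    assume "j \<in> (\<lambda>j. (j + e) mod 11) ` level S l"
    then obtain i where i: "0 \<le> i" "i < 11" "11 * l + i \<in> S" "j = (i + e) mod 11"
      by (auto simp: level_def)
    have "(11 * l + j - e) mod 11 = i"
      using i(1,2) unfolding i(4) mod_11_level
      by (simp only: mod_diff_left_eq add_diff_cancel_right' mod_pos_pos_trivial)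
    with i show "j \<in> level (rotate_level e l S) l"
      by (simp add: level_def rotate_level_def)
  qed
  with True show ?thesis by auto
next
  case False
  then show ?thesis
    by (auto simp: level_def rotate_level_def)
qed

lemma inj_on_rotation: "inj_on (\<lambda>j. (j + e) mod 11) {0..<11::int}"
proof (rule inj_onI)
  fix i j :: int assume "i \<in> {0..<11}" "j \<in> {0..<11}" "(i + e) mod 11 = (j + e) mod 11"
  then show "i = j"
    by (intro eq_if_dvd_11_diff) (simp_all add: mod_eq_dvd_iff)
qed

text \<open>A rotation permutes the eleven colours, so it neither fills nor empties a level. A level
  chosen from \<open>mixed S\<close> alone is therefore the same throughout the orbit.\<close>

lemma mixed_rotate_level: "mixed (rotate_level e l S) = mixed S"
proof -
  let ?r = "\<lambda>j::int. (j + e) mod 11"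
  have r: "?r ` {0..<11} = {0..<11}"
    by (rule endo_inj_surj[OF _ _ inj_on_rotation]) auto
  have "level S l \<subseteq> {0..<11}" by (auto simp: level_def)
  then have "?r ` level S l = {0..<11} \<longleftrightarrow> level S l = {0..<11}"
    using r inj_on_image_eq_iff[OF inj_on_rotation, of "level S l" "{0..<11}" e] by simp
  then show ?thesis
    by (auto simp: mixed_def level_rotate_level split: if_splits)
qed

lemma rsum_rotate_level:
  assumes "maya S"
  shows "maya (rotate_level e l S)"
    and "rsum g (rotate_level e l S) = rsum g S
      + ((\<Sum>j\<in>level S l. g (11 * l + (j + e) mod 11)) - (\<Sum>j\<in>level S l. g (11 * l + j)))"
proof -
  let ?S = "rotate_level e l S" and ?K = "(\<lambda>j. 11 * l + j) ` {0..<11}"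
  have out: "s \<in> ?S \<longleftrightarrow> s \<in> S" if "s \<notin> ?K" for s
  proof -
    have "s div 11 \<noteq> l"
    proof
      assume "s div 11 = l"
      then have "s = 11 * l + s mod 11" by auto
      then have "s \<in> ?K" by (rule image_eqI) simp
      with that show False by simp
    qed
    then show ?thesis by (simp add: rotate_level_def)
  qed
  have K: "finite ?K" by simp
  show "maya ?S" by (rule rsum_local_change(1)[OF assms K out])
  have sub: "{0..<11} \<inter> {j. 11 * l + j \<in> X} = level X l" for X
    by (auto simp: level_def)
  have "(\<Sum>s\<in>?K. g s * (of_bool (s \<in> ?S) - of_bool (s \<in> S))) =
      (\<Sum>j=0..<11. g (11 * l + j) * of_bool (11 * l + j \<in> ?S)) - (\<Sum>j=0..<11. g (11 * l + j) * of_bool (11 * l + j \<in> S))"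
    by (subst sum.reindex) (auto simp: inj_on_def right_diff_distrib sum_subtractf)
  also have "\<dots> = (\<Sum>j\<in>level ?S l. g (11 * l + j)) - (\<Sum>j\<in>level S l. g (11 * l + j))"
    by (simp add: sum.If_cases of_bool_def if_distrib sub cong: if_cong)
  also have "(\<Sum>j\<in>level ?S l. g (11 * l + j)) = (\<Sum>j\<in>level S l. g (11 * l + (j + e) mod 11))"
  proof -
    have "inj_on (\<lambda>j. (j + e) mod 11) (level S l)"
      by (rule inj_on_subset[OF inj_on_rotation]) (auto simp: level_def)
    then show ?thesis
      by (simp add: level_rotate_level sum.reindex)
  qed
  finally show "rsum g ?S = rsum g S
      + ((\<Sum>j\<in>level S l. g (11 * l + (j + e) mod 11)) - (\<Sum>j\<in>level S l. g (11 * l + j)))"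
    using rsum_local_change(2)[OF assms K out, of g] by simp
qed

lemma charge_rotate_level: "maya S \<Longrightarrow> charge (rotate_level e l S) = charge S"
  by (simp add: rsum_rotate_level)

lemma rsum_div_rotate_level:
  assumes "maya S"
  shows "rsum (\<lambda>s. s div 11) (rotate_level e l S) = rsum (\<lambda>s. s div 11) S"
proof -
  have "(\<Sum>j\<in>level S l. (11 * l + (j + e) mod 11) div 11) = (\<Sum>j\<in>level S l. (11 * l + j) div 11)"
    by (intro sum.cong refl) (auto simp: level_def)
  then show ?thesis
    using rsum_rotate_level(2)[OF assms, of "\<lambda>s. s div 11" e l] by simp
qed

text \<open>Each occupied colour of the level gains \<open>e\<close> modulo 11, and nothing else
  changes.\<close>

lemma rsum_mod_rotate_level:
  assumes "maya S"
  shows "rsum (\<lambda>s. s mod 11) (rotate_level e l S) mod 11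
    = (rsum (\<lambda>s. s mod 11) S + e * int (card (level S l))) mod 11"
proof -
  have "(\<Sum>j\<in>level S l. (11 * l + (j + e) mod 11) mod 11) mod 11 = (\<Sum>j\<in>level S l. j + e) mod 11"
    by (rule sum_mod_cong) (simp add: mod_simps)
  also have "(\<Sum>j\<in>level S l. j + e) = (\<Sum>j\<in>level S l. (11 * l + j) mod 11) + e * int (card (level S l))"
  proof -
    have "(\<Sum>j\<in>level S l. j) = (\<Sum>j\<in>level S l. (11 * l + j) mod 11)"
      by (intro sum.cong refl) (auto simp: level_def)
    then show ?thesis by (simp add: sum.distrib)
  qed
  finally obtain a where "(\<Sum>j\<in>level S l. (11 * l + (j + e) mod 11) mod 11) =
      (\<Sum>j\<in>level S l. (11 * l + j) mod 11) + e * int (card (level S l)) + 11 * a"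
    by (elim mod_eqE[OF sym])
  then have "rsum (\<lambda>s. s mod 11) (rotate_level e l S) =
      (rsum (\<lambda>s. s mod 11) S + e * int (card (level S l))) + 11 * a"
    using rsum_rotate_level(2)[OF assms, of "\<lambda>s. s mod 11" e l] by linarith
  then show ?thesis by (simp only: mod_mult_self2)
qed

section \<open>Equidistribution of colour sums over diagrams with a mixed level\<close>

lemma card_solutions_mod_11:
  fixes t d :: int
  assumes "0 < d" "d < 11"
  shows "card {e \<in> {0..<11}. (t + e * d) mod 11 = 1} = 1"
proof -
  let ?f = "\<lambda>e. (t + e * d) mod 11"
  have inj: "inj_on ?f {0..<11}"
  proof (rule inj_onI)
    fix a b :: int assume ab: "a \<in> {0..<11}" "b \<in> {0..<11}" "?f a = ?f b"
    \<comment> \<open>Since 11 is prime, \<open>d\<close> can be cancelled modulo 11; this is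
      checked for each of its ten possible values.\<close>
    have "d = 1 \<or> d = 2 \<or> d = 3 \<or> d = 4 \<or> d = 5 \<or> d = 6 \<or> d = 7 \<or> d = 8 \<or> d = 9 \<or> d = 10"
      using assms by presburger
    moreover from ab(3) have "11 dvd (a - b) * d"
      by (simp add: mod_eq_dvd_iff left_diff_distrib)
    moreover have "11 dvd x" if "11 dvd x * 2 \<or> 11 dvd x * 3 \<or> 11 dvd x * 4 \<or> 11 dvd x * 5 \<or>
        11 dvd x * 6 \<or> 11 dvd x * 7 \<or> 11 dvd x * 8 \<or> 11 dvd x * 9 \<or> 11 dvd x * 10" for x :: int
      using that by presburger
    ultimately have "11 dvd a - b"
      by (metis mult.right_neutral)
    then show "a = b"
      using ab(1,2) by (intro eq_if_dvd_11_diff)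
  qed
  have "?f ` {0..<11} = {0..<11}"
    by (rule endo_inj_surj[OF _ _ inj]) auto
  then have "1 \<in> ?f ` {0..<11}" by simp
  then obtain e where "e \<in> {0..<11}" "?f e = 1"
    by (elim imageE) simp
  with inj have "{e \<in> {0..<11}. ?f e = 1} = {e}"
    by (auto intro: inj_onD[OF inj])
  then show ?thesis by simp
qed


text \<open>Double counting of the pairs of a rotation \<open>e\<close> and a diagram
  \<open>S\<close> whose rotated colour sum is 1. For fixed \<open>e\<close>, rotation is a
  bijection of \<open>N\<close>, so each of the eleven \<open>e\<close> contributes the same number;
  for fixed \<open>S\<close> exactly one \<open>e\<close> works.\<close>

lemma card_mixed_residue_one:
  fixes n :: int
  defines "N \<equiv> {S. maya S \<and> charge S = 0 \<and> rsum (\<lambda>s. s div 11) S = n \<and> mixed S \<noteq> {}}"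
  assumes fin: "finite N"
  shows "11 * card {S \<in> N. rsum (\<lambda>s. s mod 11) S mod 11 = 1} = card N"
proof -
  define T where "T S = rsum (\<lambda>s. s mod 11) S" for S
  \<comment> \<open>The choice depends on \<open>S\<close> only through \<open>mixed S\<close>,
    which rotation preserves; this makes \<open>F\<close> additive in \<open>e\<close>.\<close>
  define pick where "pick S = (SOME l. l \<in> mixed S)" for S
  define F where "F e S = rotate_level e (pick S) S" for e S
  have pick_F: "pick (F e S) = pick S" for e S
    by (simp add: pick_def F_def mixed_rotate_level)
  have F_N: "F e S \<in> N" if "S \<in> N" for e S
    using that unfolding N_def F_def
    by (simp add: rsum_rotate_level(1) charge_rotate_level rsum_div_rotate_level mixed_rotate_level)
  have F_F: "F a (F b S) = F (a + b) S" for a b S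
    unfolding F_def[of a] pick_F by (simp add: F_def rotate_rotate_level)
  have F_0: "F 0 S = S" for S
    by (simp add: F_def rotate_level_0)
  have T_F: "T (F e S) mod 11 = (T S + e * int (card (level S (pick S)))) mod 11" if "S \<in> N" for e S
    using that unfolding N_def F_def T_def by (intro rsum_mod_rotate_level) simp
  have d: "0 < int (card (level S (pick S))) \<and> int (card (level S (pick S))) < 11" if "S \<in> N" for S
  proof -
    have "pick S \<in> mixed S"
      using that unfolding N_def pick_def by (simp add: some_in_eq)
    then have ne: "level S (pick S) \<noteq> {}" "level S (pick S) \<subset> {0..<11}"
      by (auto simp: mixed_def level_def)
    have "finite (level S (pick S))"
      by (rule finite_subset[of _ "{0..<11}"]) (use ne(2) in auto)
    moreover have "card (level S (pick S)) < card {0..<11::int}"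
      by (rule psubset_card_mono[OF _ ne(2)]) simp
    ultimately show ?thesis
      using ne(1) by (simp add: card_gt_0_iff)
  qed
  have bij: "bij_betw (F e) {S \<in> N. T (F e S) mod 11 = 1} {S \<in> N. T S mod 11 = 1}" for e
    by (rule bij_betw_byWitness[where f' = "F (- e)"]) (auto simp: F_F F_0 F_N)
  have "11 * card {S \<in> N. T S mod 11 = 1} = (\<Sum>e\<in>{0..<11::int}. card {S \<in> N. T (F e S) mod 11 = 1})"
    using bij_betw_same_card[OF bij] by simp
  also have "\<dots> = (\<Sum>e\<in>{0..<11::int}. \<Sum>S\<in>N. of_bool (T (F e S) mod 11 = 1))"
    using fin by (simp add: of_bool_def sum.If_cases Collect_conj_eq)
  also have "\<dots> = (\<Sum>S\<in>N. \<Sum>e\<in>{0..<11::int}. of_bool (T (F e S) mod 11 = 1))"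
    by (rule sum.swap)
  also have "\<dots> = (\<Sum>S\<in>N. 1)"
  proof (rule sum.cong)
    fix S assume S: "S \<in> N"
    have "(\<Sum>e\<in>{0..<11::int}. of_bool (T (F e S) mod 11 = 1)) =
        card {e \<in> {0..<11}. (T S + e * int (card (level S (pick S)))) mod 11 = 1}"
      unfolding T_F[OF S] by (simp add: of_bool_def sum.If_cases Int_def)
    also have "\<dots> = 1"
      using d[OF S] by (intro card_solutions_mod_11) auto
    finally show "(\<Sum>e\<in>{0..<11::int}. of_bool (T (F e S) mod 11 = 1)) = (1::nat)" .
  qed simp
  finally show ?thesis by (simp add: T_def)
qed

section \<open>Diagrams without a mixed level\<close>

definition thicken :: "int set \<Rightarrow> int set" where
  "thicken S = {s. s div 11 \<in> S}"

lemma runner_thicken: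
  assumes "j \<in> {0..<11}"
  shows "runner 11 j (thicken S) = S"
  unfolding runner_def thicken_def mem_Collect_eq div_mod_runner_index(1)[OF assms] by simp

lemma maya_thicken: "maya S \<Longrightarrow> maya (thicken S)"
  by (rule maya_if_runners[of 11]) (simp_all add: runner_thicken)

lemma mixed_empty_iff: "mixed S = {} \<longleftrightarrow> S \<in> range thicken"
proof
  assume "mixed S = {}"
  then have lev: "level S l = {} \<or> level S l = {0..<11}" for l
    by (auto simp: mixed_def)
  have "s \<in> S \<longleftrightarrow> s \<in> thicken {l. 11 * l \<in> S}" for s
  proof -
    have "s \<in> S \<longleftrightarrow> s mod 11 \<in> level S (s div 11)"
      by (simp add: level_def)
    also have "\<dots> \<longleftrightarrow> 0 \<in> level S (s div 11)"
      using lev[of "s div 11"] by (elim disjE) simp_all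
    also have "\<dots> \<longleftrightarrow> s \<in> thicken {l. 11 * l \<in> S}"
      by (simp add: level_def thicken_def)
    finally show ?thesis .
  qed
  then show "S \<in> range thicken" by blast
next
  assume "S \<in> range thicken"
  then obtain S' where "S = thicken S'" by blast
  then have "j \<in> level S l \<longleftrightarrow> j \<in> {0..<11} \<and> l \<in> S'" for j l
    using div_mod_runner_index(1)[of j 11 l] by (auto simp: level_def thicken_def)
  then show "mixed S = {}"
    by (auto simp: mixed_def)
qed

text \<open>All eleven runners equal \<open>S\<close>, and 55 is 0 + 1 + ... + 10. At charge zero
  the colour sum is thus 0, so no thickened diagram has colour sum 1.\<close>

lemma rsum_thicken:
  assumes "maya S"
  shows "charge (thicken S) = 11 * charge S"
    and "rsum (\<lambda>s. s div 11) (thicken S) = 11 * energy S"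
    and "rsum (\<lambda>s. s mod 11) (thicken S) = 55 * charge S"
proof -
  note m = maya_thicken[OF assms]
  show "charge (thicken S) = 11 * charge S"
    unfolding charge_runners[OF m] by (simp add: runner_thicken)
  show "rsum (\<lambda>s. s div 11) (thicken S) = 11 * energy S"
    unfolding rsum_div_runners[OF m] by (simp add: runner_thicken)
  show "rsum (\<lambda>s. s mod 11) (thicken S) = 55 * charge S"
    unfolding rsum_mod_runners[OF m] by (simp add: runner_thicken atLeastLessThan_11)
qed

text \<open>Diagrams without a mixed level are thickenings and give the first summand. They never
  have colour sum 1, so the last set consists of mixed diagrams only, and those are equidistributed
  over the colour sums.\<close>

lemma card_eq_unmixed_plus_residue_one:
  assumes fin: "finite {S. maya S \<and> charge S = 0 \<and> rsum (\<lambda>s. s div 11) S = n}"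
  shows "card {S. maya S \<and> charge S = 0 \<and> rsum (\<lambda>s. s div 11) S = n} =
    card {S. maya S \<and> charge S = 0 \<and> 11 * energy S = n} +
    11 * card {S. maya S \<and> charge S = 0 \<and> rsum (\<lambda>s. s div 11) S = n \<and> rsum (\<lambda>s. s mod 11) S mod 11 = 1}"
proof -
  let ?A = "{S. maya S \<and> charge S = 0 \<and> rsum (\<lambda>s. s div 11) S = n}"
  let ?N = "{S. maya S \<and> charge S = 0 \<and> rsum (\<lambda>s. s div 11) S = n \<and> mixed S \<noteq> {}}"
  let ?P = "{S. maya S \<and> charge S = 0 \<and> rsum (\<lambda>s. s div 11) S = n \<and> mixed S = {}}"
  have maya_iff: "maya (thicken S) \<longleftrightarrow> maya S" for S
    using maya_thicken[of S] maya_runner[of "thicken S" 0 11] runner_thicken[of 0 S] by auto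
  have inj: "inj thicken"
    by (rule inj_on_inverseI[where g = "runner 11 0"]) (simp add: runner_thicken)
  have "?P = thicken ` {S. maya S \<and> charge S = 0 \<and> 11 * energy S = n}"
    unfolding mixed_empty_iff by (auto simp: maya_iff rsum_thicken)
  then have P: "card ?P = card {S. maya S \<and> charge S = 0 \<and> 11 * energy S = n}"
    by (simp add: card_image inj_on_subset[OF inj])
  have PT: "rsum (\<lambda>s. s mod 11) S = 0" if "S \<in> ?P" for S
    using that unfolding mixed_empty_iff by (auto simp: maya_iff rsum_thicken)
  have N: "finite ?N" "finite ?P"
    by (rule finite_subset[OF _ fin]; blast)+
  have "{S \<in> ?N. rsum (\<lambda>s. s mod 11) S mod 11 = 1} =
      {S. maya S \<and> charge S = 0 \<and> rsum (\<lambda>s. s div 11) S = n \<and> rsum (\<lambda>s. s mod 11) S mod 11 = 1}"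
    using PT by force
  with card_mixed_residue_one[OF N(1)] have
    "11 * card {S. maya S \<and> charge S = 0 \<and> rsum (\<lambda>s. s div 11) S = n \<and> rsum (\<lambda>s. s mod 11) S mod 11 = 1}
      = card ?N"
    by simp
  moreover have "?A = ?P \<union> ?N" "?P \<inter> ?N = {}" by auto
  ultimately show ?thesis
    using card_Un_disjoint[OF N(2,1)] P by simp
qed

section \<open>Frobenius symbols\<close>

text \<open>Colours are shifted to start at 0, so that value and colour become quotient and
  remainder modulo \<open>k\<close> and the order on coloured integers becomes the usual
  one.\<close>

definition row_code :: "nat \<Rightarrow> colored \<Rightarrow> int" where
  "row_code k x = int k * int (fst x) + (int (snd x) - 1)"

definition row_decode :: "nat \<Rightarrow> int \<Rightarrow> colored" where
  "row_decode k s = (nat (s div int k), Suc (nat (s mod int k)))"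

lemma row_code_div:
  assumes "snd x \<in> {1..k}"
  shows "row_code k x div int k = int (fst x)" "row_code k x mod int k = int (snd x) - 1"
    "0 \<le> row_code k x"
proof -
  have j: "int (snd x) - 1 \<in> {0..<int k}" using assms by auto
  show "row_code k x div int k = int (fst x)" "row_code k x mod int k = int (snd x) - 1"
    unfolding row_code_def by (rule div_mod_runner_index[OF j])+
  show "0 \<le> row_code k x"
    using assms by (simp add: row_code_def)
qed

lemma row_decode_code: "snd x \<in> {1..k} \<Longrightarrow> row_decode k (row_code k x) = x"
  by (auto simp: row_decode_def row_code_div prod_eq_iff Suc_nat_eq_nat_zadd1)

lemma row_code_decode:
  assumes "0 < k" "0 \<le> s"
  shows "row_code k (row_decode k s) = s" "snd (row_decode k s) \<in> {1..k}"
proof -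
  have "0 \<le> s div int k" using assms by (simp add: pos_imp_zdiv_nonneg_iff)
  moreover have m: "0 \<le> s mod int k" "s mod int k < int k" using assms by simp_all
  ultimately show "row_code k (row_decode k s) = s"
    by (simp add: row_code_def row_decode_def)
  show "snd (row_decode k s) \<in> {1..k}"
    using m by (simp add: row_decode_def)
qed

lemma colored_less_iff_row_code:
  assumes "snd x \<in> {1..k}" "snd y \<in> {1..k}"
  shows "colored_less x y \<longleftrightarrow> row_code k x < row_code k y"
proof -
  have less: "row_code k x < row_code k y"
    if "colored_less x y" and xy: "snd x \<in> {1..k}" "snd y \<in> {1..k}" for x y
  proof (cases "fst x < fst y")
    case True
    then have "int k * (int (fst x) + 1) \<le> int k * int (fst y)"
      by (intro mult_left_mono) auto
    then show ?thesis using xy by (simp add: row_code_def distrib_left)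
  next
    case False
    then show ?thesis using that by (auto simp: colored_less_def row_code_def)
  qed
  have "colored_less x y \<or> x = y \<or> colored_less y x"
    by (auto simp: colored_less_def prod_eq_iff)
  then show ?thesis
    using less[of x y] less[of y x] assms by fastforce
qed

text \<open>A strictly decreasing row is determined by its set of entries, and
  \<open>row_code\<close> is an order isomorphism onto the nonnegative integers. The inverse lists
  the set in decreasing order and decodes.\<close>

lemma bij_betw_frobenius_row:
  assumes "0 < k"
  shows "bij_betw (\<lambda>r. row_code k ` set r) {r. frobenius_row k r} {A. finite A \<and> A \<subseteq> {0..}}"
proof (rule bij_betw_byWitness[where f' = "\<lambda>A. map (row_decode k) (rev (sorted_list_of_set A))"])
  have "map (row_decode k) (rev (sorted_list_of_set (row_code k ` set r))) = r"
    if "frobenius_row k r" for r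
  proof -
    have col: "snd x \<in> {1..k}" if "x \<in> set r" for x
      using \<open>frobenius_row k r\<close> that by (simp add: frobenius_row_def)
    have "sorted_wrt (\<lambda>x y. row_code k y < row_code k x) r"
      using \<open>frobenius_row k r\<close> unfolding frobenius_row_def
      by (elim conjE sorted_wrt_mono_rel[rotated]) (simp add: colored_less_iff_row_code[OF col col])
    then have "sorted_wrt (<) (rev (map (row_code k) r))"
      by (simp add: sorted_wrt_rev sorted_wrt_map)
    then have "sorted_list_of_set (set (rev (map (row_code k) r))) = rev (map (row_code k) r)"
      by (intro sorted_list_of_set.idem_if_sorted_distinct) (simp_all add: strict_sorted_iff)
    then have "rev (sorted_list_of_set (row_code k ` set r)) = map (row_code k) r"
      by simp
    then show ?thesis
      using col by (simp add: row_decode_code map_idI)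
  qed
  then show "\<forall>r\<in>{r. frobenius_row k r}. map (row_decode k) (rev (sorted_list_of_set (row_code k ` set r))) = r"
    by blast
  have B: "row_code k ` set (map (row_decode k) (rev (sorted_list_of_set A))) = A"
    "frobenius_row k (map (row_decode k) (rev (sorted_list_of_set A)))"
    if A: "finite A" "A \<subseteq> {0..}" for A
  proof -
    have pos: "0 \<le> a" if "a \<in> A" for a
      using A that by auto
    note dec = row_code_decode[OF assms pos]
    then show "row_code k ` set (map (row_decode k) (rev (sorted_list_of_set A))) = A"
      using A by (simp add: image_image)
    have "sorted_wrt (\<lambda>a b. b < a) (rev (sorted_list_of_set A))"
      by (simp add: sorted_wrt_rev)
    then have "sorted_wrt (\<lambda>a b. colored_less (row_decode k b) (row_decode k a)) (rev (sorted_list_of_set A))"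
      using A by (elim sorted_wrt_mono_rel[rotated])
        (simp add: colored_less_iff_row_code[OF dec(2) dec(2)] dec(1))
    then show "frobenius_row k (map (row_decode k) (rev (sorted_list_of_set A)))"
      using A dec by (auto simp: frobenius_row_def sorted_wrt_map)
  qed
  then show "\<forall>A\<in>{A. finite A \<and> A \<subseteq> {0..}}.
      row_code k ` set (map (row_decode k) (rev (sorted_list_of_set A))) = A"
    by blast
  show "(\<lambda>r. row_code k ` set r) ` {r. frobenius_row k r} \<subseteq> {A. finite A \<and> A \<subseteq> {0..}}"
    using row_code_div(3) by (fastforce simp: frobenius_row_def)
  show "(\<lambda>A. map (row_decode k) (rev (sorted_list_of_set A))) ` {A. finite A \<and> A \<subseteq> {0..}} \<subseteq> {r. frobenius_row k r}"
    using B(2) by blast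
qed

lemma frobenius_row_sums:
  assumes "frobenius_row k r"
  shows "card (row_code k ` set r) = length r"
    and "(\<Sum>a\<in>row_code k ` set r. a div int k) = int (sum_list (map fst r))"
proof -
  have col: "snd x \<in> {1..k}" if "x \<in> set r" for x
    using assms that by (simp add: frobenius_row_def)
  have inj: "inj_on (row_code k) (set r)"
    by (rule inj_on_inverseI[where g = "row_decode k"]) (rule row_decode_code[OF col])
  have "sorted_wrt (\<lambda>x y. y \<noteq> x) r"
    using assms unfolding frobenius_row_def
    by (elim conjE sorted_wrt_mono_rel[rotated]) (auto simp: colored_less_def)
  then have d: "distinct r"
    by (induction r) auto
  show "card (row_code k ` set r) = length r"
    using inj d by (simp add: card_image distinct_card)
  show "(\<Sum>a\<in>row_code k ` set r. a div int k) = int (sum_list (map fst r))"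
    using inj d col by (simp add: sum.reindex row_code_div sum_list_distinct_conv_sum_set)
qed

text \<open>Holes carry their colours in reverse order, which does not affect the weight.\<close>

definition particles_holes :: "int set \<times> int set \<Rightarrow> int set" where
  "particles_holes = (\<lambda>(A, B). A \<union> ({..<0} - (\<lambda>b. - 1 - b) ` B))"

lemma particles_holes_iff:
  assumes "A \<subseteq> {0..}" "B \<subseteq> {0..}"
  shows "s \<in> particles_holes (A, B) \<longleftrightarrow> (if 0 \<le> s then s \<in> A else - 1 - s \<notin> B)"
proof -
  have "s \<in> (\<lambda>b. - 1 - b) ` B \<longleftrightarrow> - 1 - s \<in> B"
    by force
  then show ?thesis
    using assms by (auto simp: particles_holes_def)
qed

lemma particles_holes_support:
  assumes "A \<subseteq> {0..}" "B \<subseteq> {0..}"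
  shows "{s. (s \<in> particles_holes (A, B)) \<noteq> (s < 0)} = A \<union> (\<lambda>b. - 1 - b) ` B"
proof -
  have "s \<in> (\<lambda>b. - 1 - b) ` B \<longleftrightarrow> - 1 - s \<in> B" for s
    by force
  then show ?thesis
    using assms by (auto simp: particles_holes_iff split: if_splits)
qed

lemma bij_betw_particles_holes:
  "bij_betw particles_holes ({A. finite A \<and> A \<subseteq> {0..}} \<times> {B. finite B \<and> B \<subseteq> {0..}}) {S. maya S}"
proof (rule bij_betw_byWitness[where f' = "\<lambda>S. (S \<inter> {0..}, {b. 0 \<le> b \<and> - 1 - b \<notin> S})"])
  show "\<forall>p\<in>{A. finite A \<and> A \<subseteq> {0..}} \<times> {B. finite B \<and> B \<subseteq> {0..}}.
      (particles_holes p \<inter> {0..}, {b. 0 \<le> b \<and> - 1 - b \<notin> particles_holes p}) = p"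
    by (auto simp: particles_holes_iff)
  show "\<forall>S\<in>{S. maya S}. particles_holes (S \<inter> {0..}, {b. 0 \<le> b \<and> - 1 - b \<notin> S}) = S"
  proof
    fix S :: "int set"
    have "s \<in> particles_holes (S \<inter> {0..}, {b. 0 \<le> b \<and> - 1 - b \<notin> S}) \<longleftrightarrow> s \<in> S" for s
      by (subst particles_holes_iff) auto
    then show "particles_holes (S \<inter> {0..}, {b. 0 \<le> b \<and> - 1 - b \<notin> S}) = S"
      by blast
  qed
  show "particles_holes ` ({A. finite A \<and> A \<subseteq> {0..}} \<times> {B. finite B \<and> B \<subseteq> {0..}}) \<subseteq> {S. maya S}"
  proof (rule image_subsetI)
    fix p :: "int set \<times> int set"
    assume "p \<in> {A. finite A \<and> A \<subseteq> {0..}} \<times> {B. finite B \<and> B \<subseteq> {0..}}"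
    then have "finite {s. (s \<in> particles_holes (fst p, snd p)) \<noteq> (s < 0)}"
      by (subst particles_holes_support) auto
    then show "particles_holes p \<in> {S. maya S}"
      by (simp add: maya_def)
  qed
  show "(\<lambda>S. (S \<inter> {0..}, {b. 0 \<le> b \<and> - 1 - b \<notin> S})) ` {S. maya S}
      \<subseteq> {A. finite A \<and> A \<subseteq> {0..}} \<times> {B. finite B \<and> B \<subseteq> {0..}}"
  proof (rule image_subsetI)
    fix S :: "int set" assume "S \<in> {S. maya S}"
    then have fin: "finite {s. (s \<in> S) \<noteq> (s < 0)}" by (simp add: maya_def)
    have "finite (S \<inter> {0..})"
      by (rule finite_subset[OF _ fin]) auto
    moreover have "finite {b. 0 \<le> b \<and> - 1 - b \<notin> S}"
    proof (rule finite_subset)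
      show "{b. 0 \<le> b \<and> - 1 - b \<notin> S} \<subseteq> (\<lambda>s. - 1 - s) ` {s. (s \<in> S) \<noteq> (s < 0)}"
      proof
        fix b assume "b \<in> {b. 0 \<le> b \<and> - 1 - b \<notin> S}"
        then have "- 1 - b \<in> {s. (s \<in> S) \<noteq> (s < 0)}" "b = - 1 - (- 1 - b)" by auto
        then show "b \<in> (\<lambda>s. - 1 - s) ` {s. (s \<in> S) \<noteq> (s < 0)}" by blast
      qed
    qed (use fin in simp)
    ultimately show "(S \<inter> {0..}, {b. 0 \<le> b \<and> - 1 - b \<notin> S})
        \<in> {A. finite A \<and> A \<subseteq> {0..}} \<times> {B. finite B \<and> B \<subseteq> {0..}}"
      by auto
  qed
qed

lemma rsum_particles_holes:
  assumes "finite A" "A \<subseteq> {0..}" "finite B" "B \<subseteq> {0..}"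
  shows "rsum g (particles_holes (A, B)) = (\<Sum>a\<in>A. g a) - (\<Sum>b\<in>B. g (- 1 - b))"
proof -
  have "rsum g (particles_holes (A, B)) = (\<Sum>s\<in>A \<union> (\<lambda>b. - 1 - b) ` B.
      g s * (of_bool (s \<in> particles_holes (A, B)) - of_bool (s < 0)))"
    using assms(1,3) equalityD1[OF particles_holes_support[OF assms(2,4)]]
    by (intro rsum_eq_sum) simp
  also have "\<dots> = (\<Sum>s\<in>A. g s * (of_bool (s \<in> particles_holes (A, B)) - of_bool (s < 0))) +
      (\<Sum>s\<in>(\<lambda>b. - 1 - b) ` B. g s * (of_bool (s \<in> particles_holes (A, B)) - of_bool (s < 0)))"
    using assms by (intro sum.union_disjoint) (auto, fastforce)
  also have "(\<Sum>s\<in>A. g s * (of_bool (s \<in> particles_holes (A, B)) - of_bool (s < 0))) = (\<Sum>a\<in>A. g a)"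
    using assms by (intro sum.cong refl) (auto simp: particles_holes_iff)
  also have "(\<Sum>s\<in>(\<lambda>b. - 1 - b) ` B. g s * (of_bool (s \<in> particles_holes (A, B)) - of_bool (s < 0))) =
      (\<Sum>s\<in>(\<lambda>b. - 1 - b) ` B. - g s)"
    using assms by (intro sum.cong refl) (auto simp: particles_holes_iff)
  also have "\<dots> = - (\<Sum>b\<in>B. g (- 1 - b))"
    by (subst sum.reindex) (auto simp: inj_on_def sum_negf)
  finally show ?thesis by simp
qed

lemma bij_betw_filter:
  assumes "bij_betw f A B"
  shows "bij_betw f {x \<in> A. P (f x)} {y \<in> B. P y}"
  using assms by (auto simp: bij_betw_def inj_on_def)

text \<open>The top row gives the particles, the bottom row the holes \<open>- 1 - b\<close>. Rows
  of equal length mean charge 0; a hole weighs \<open>b div k + 1\<close>, and the ones add up to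
  the number of columns in the size.\<close>

lemma bij_betw_frobenius_partitions:
  assumes "0 < k"
  shows "bij_betw (\<lambda>(r, t). particles_holes (row_code k ` set r, row_code k ` set t))
    (frobenius_partitions k n) {S. maya S \<and> charge S = 0 \<and> rsum (\<lambda>s. s div int k) S = int n}"
proof -
  let ?f = "\<lambda>r. row_code k ` set r"
  let ?F = "\<lambda>(r, t). particles_holes (?f r, ?f t)"
  let ?R = "{r. frobenius_row k r}" and ?M = "{S. maya S}"
  let ?P = "\<lambda>S. charge S = 0 \<and> rsum (\<lambda>s. s div int k) S = int n"
  have "?F = particles_holes \<circ> map_prod ?f ?f"
    by auto
  then have bij: "bij_betw ?F (?R \<times> ?R) ?M"
    using bij_betw_trans[OF bij_betw_map_prod[OF bij_betw_frobenius_row[OF assms] bij_betw_frobenius_row[OF assms]]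
        bij_betw_particles_holes]
    by simp
  have iff: "?P (?F (r, t)) \<longleftrightarrow> length r = length t \<and> frobenius_size (r, t) = n"
    if r: "frobenius_row k r" and t: "frobenius_row k t" for r t
  proof -
    have sub: "?f r \<subseteq> {0..}" "?f t \<subseteq> {0..}"
      using r t row_code_div(3) by (fastforce simp: frobenius_row_def)+
    \<comment> \<open>Reflection sends level \<open>l\<close> to level \<open>- 1 - l\<close> and
      reverses the remainders, which stay between 0 and \<open>k - 1\<close>.\<close>
    have neg: "(- 1 - b) div int k = - 1 - b div int k" for b
    proof -
      have "- 1 - b = int k * (- 1 - b div int k) + (int k - 1 - b mod int k)"
        by (simp add: algebra_simps)
      moreover have "int k - 1 - b mod int k \<in> {0..<int k}"
        using assms pos_mod_bound[of "int k" b] pos_mod_sign[of "int k" b]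
        unfolding atLeastLessThan_iff by linarith
      ultimately show ?thesis
        by (metis div_mod_runner_index(1))
    qed
    have "charge (particles_holes (?f r, ?f t)) = int (length r) - int (length t)"
      using r t sub by (simp add: rsum_particles_holes frobenius_row_sums)
    moreover have "rsum (\<lambda>s. s div int k) (particles_holes (?f r, ?f t)) =
        int (sum_list (map fst r)) + int (length t) + int (sum_list (map fst t))"
    proof -
      have "(\<Sum>b\<in>?f t. (- 1 - b) div int k) = - int (length t) - int (sum_list (map fst t))"
        using t by (simp only: neg sum_subtractf frobenius_row_sums sum_constant)
      then show ?thesis
        using r sub by (simp add: rsum_particles_holes frobenius_row_sums)
    qed
    ultimately show ?thesis
      by (auto simp: frobenius_size_def)
  qed
  have "frobenius_partitions k n = {p \<in> ?R \<times> ?R. ?P (?F p)}"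
  proof (rule set_eqI)
    fix p :: "colored list \<times> colored list"
    have "p \<in> frobenius_partitions k n \<longleftrightarrow> frobenius_row k (fst p) \<and> frobenius_row k (snd p) \<and>
        (length (fst p) = length (snd p) \<and> frobenius_size (fst p, snd p) = n)"
      by (auto simp: frobenius_partitions_def frobenius_symbol_def)
    also have "\<dots> \<longleftrightarrow> frobenius_row k (fst p) \<and> frobenius_row k (snd p) \<and> ?P (?F (fst p, snd p))"
      using iff[of "fst p" "snd p"] by blast
    finally show "p \<in> frobenius_partitions k n \<longleftrightarrow> p \<in> {p \<in> ?R \<times> ?R. ?P (?F p)}"
      by (simp add: mem_Times_iff)
  qed
  with bij_betw_filter[OF bij, of ?P] show ?thesis
    by (simp only: mem_Collect_eq)
qed

section \<open>Partitions\<close>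

lemma maya_Un_negative:
  assumes "finite X" "X \<subseteq> {0..}"
  shows "maya (X \<union> {..<0})" "rsum g (X \<union> {..<0}) = sum g X"
proof -
  have supp: "{s. (s \<in> X \<union> {..<0}) \<noteq> (s < 0)} \<subseteq> X"
    by auto
  then show "maya (X \<union> {..<0})"
    unfolding maya_def using assms(1) by (rule finite_subset)
  show "rsum g (X \<union> {..<0}) = sum g X"
    unfolding rsum_eq_sum[OF assms(1) supp] using assms(2) by (intro sum.cong) auto
qed

text \<open>Particles and holes contribute nonnegative terms to the energy, so a single hole already
  bounds it from below.\<close>

lemma energy_ge_hole:
  assumes "maya S" "s < 0" "s \<notin> S"
  shows "- s \<le> energy S"
proof -
  have "s * (of_bool (s \<in> S) - of_bool (s < 0)) \<le> energy S"
    unfolding rsum_def using assms by (intro member_le_sum) (auto simp: maya_def)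
  then show ?thesis using assms by simp
qed

text \<open>The beta-sets with \<open>n\<close> elements of the partitions of \<open>n\<close>:
  subtracting 0, 1, ..., \<open>n - 1\<close> from the elements in increasing order leaves
  \<open>n\<close> parts, zeros allowed, of sum \<open>n\<close>.\<close>

definition staircase_sets :: "nat \<Rightarrow> int set set" where
  "staircase_sets n = {X. finite X \<and> X \<subseteq> {0..} \<and> card X = n \<and> 2 * \<Sum>X = 2 * int n + int n * (int n - 1)}"

text \<open>Translated by \<open>n\<close>, a diagram of energy \<open>n\<close> contains all
  negative integers, so it is determined by its finite nonnegative part.\<close>

lemma card_charge_zero_eq_staircase:
  "card {S. maya S \<and> charge S = 0 \<and> energy S = int n} = card (staircase_sets n)" (is "card ?A = card ?B")
proof -
  let ?f = "\<lambda>S. shift (int n) S \<inter> {0..}"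
  let ?g = "\<lambda>X. shift (- int n) (X \<union> {..<0})"
  have A: "?f S \<in> ?B \<and> ?g (?f S) = S" if "S \<in> ?A" for S
  proof -
    from that have S: "maya S" "charge S = 0" "energy S = int n" by simp_all
    \<comment> \<open>A hole here would come from a hole of \<open>S\<close> below
      \<open>- n\<close>, which costs more than the available energy \<open>n\<close>.\<close>
    have "s \<in> shift (int n) S" if "s < 0" for s
      using energy_ge_hole[OF S(1), of "s - int n"] that S(3) by (fastforce simp: shift_def)
    then have eq: "?f S \<union> {..<0} = shift (int n) S" by auto
    have "finite (?f S)"
      using maya_shift[OF S(1), of "int n"] unfolding maya_def
      by (rule rev_finite_subset) auto
    moreover have "?f S \<subseteq> {0..}" by simp
    ultimately have r: "rsum g (shift (int n) S) = sum g (?f S)" for g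
      using maya_Un_negative(2)[of "?f S" g] eq by simp
    have "card (?f S) = n"
      using r[of "\<lambda>_. 1"] charge_shift[OF S(1), of "int n"] S(2) by simp
    moreover have "2 * \<Sum>(?f S) = 2 * int n + int n * (int n - 1)"
      using r[of "\<lambda>s. s"] energy_shift[OF S(1), of "int n"] S by simp
    moreover have "?g (?f S) = S"
      unfolding eq by (simp add: shift_shift)
    ultimately show ?thesis
      using \<open>finite (?f S)\<close> by (simp add: staircase_sets_def)
  qed
  have B: "?g X \<in> ?A \<and> ?f (?g X) = X" if "X \<in> ?B" for X
  proof -
    from that have X: "finite X" "X \<subseteq> {0..}" "card X = n" "2 * \<Sum>X = 2 * int n + int n * (int n - 1)"
      by (simp_all add: staircase_sets_def)
    note m = maya_Un_negative[OF X(1,2)]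
    have "charge (?g X) = 0"
      unfolding charge_shift[OF m(1)] m(2) using X(3) by simp
    moreover have "2 * energy (?g X) = 2 * int n"
      unfolding energy_shift[OF m(1)] m(2) using X(3,4) by (simp add: algebra_simps)
    moreover have "?f (?g X) = X"
      using X(2) by (auto simp: shift_shift)
    ultimately show ?thesis
      using maya_shift[OF m(1)] by simp
  qed
  have "bij_betw ?f ?A ?B"
    by (rule bij_betw_byWitness[where f' = ?g]; intro ballI image_subsetI)
      (fact A[THEN conjunct2] B[THEN conjunct2] A[THEN conjunct1] B[THEN conjunct1])+
  then show ?thesis by (rule bij_betw_same_card)
qed

definition stair :: "nat list \<Rightarrow> int list" where
  "stair xs = map (\<lambda>i. int (xs ! i) + int i) [0..<length xs]"

definition unstair :: "int list \<Rightarrow> nat list" where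
  "unstair ys = map (\<lambda>i. nat (ys ! i - int i)) [0..<length ys]"

lemma strict_sorted_stair: "sorted xs \<Longrightarrow> sorted_wrt (<) (stair xs)"
  by (auto simp: stair_def sorted_wrt_iff_nth_less sorted_iff_nth_mono intro!: add_le_less_mono)

lemma unstair_stair: "unstair (stair xs) = xs"
  by (rule nth_equalityI) (simp_all add: stair_def unstair_def)

lemma strict_sorted_nth_diff:
  fixes ys :: "int list"
  assumes "sorted_wrt (<) ys" "i \<le> j" "j < length ys"
  shows "ys ! i + int (j - i) \<le> ys ! j"
  using assms(2,3)
proof (induction j rule: dec_induct)
  case (step j)
  have "ys ! j < ys ! Suc j"
    using assms(1) step.prems by (simp add: sorted_wrt_iff_nth_less)
  then show ?case using step by (simp add: Suc_diff_le)
qed simp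

text \<open>Ensures that \<open>nat\<close> in \<open>unstair\<close> never truncates a negative
  difference.\<close>

lemma strict_sorted_nth_ge:
  fixes ys :: "int list"
  assumes "sorted_wrt (<) ys" "set ys \<subseteq> {0..}" "i < length ys"
  shows "int i \<le> ys ! i"
proof -
  have "0 \<le> ys ! 0"
    using assms(2,3) nth_mem[of 0 ys] by (cases ys) auto
  then show ?thesis
    using strict_sorted_nth_diff[OF assms(1), of 0 i] assms(3) by simp
qed

lemma stair_unstair:
  assumes "sorted_wrt (<) ys" "set ys \<subseteq> {0..}"
  shows "stair (unstair ys) = ys"
  using strict_sorted_nth_ge[OF assms]
  by (intro nth_equalityI) (simp_all add: stair_def unstair_def)

lemma sorted_unstair:
  assumes "sorted_wrt (<) ys" "set ys \<subseteq> {0..}"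
  shows "sorted (unstair ys)"
proof -
  have "ys ! i - int i \<le> ys ! j - int j" if "i \<le> j" "j < length ys" for i j
    using strict_sorted_nth_diff[OF assms(1) that] that by simp
  then show ?thesis
    by (auto simp: sorted_iff_nth_mono unstair_def intro!: nat_mono)
qed

lemma sum_stair: "2 * sum_list (stair xs) = 2 * int (sum_list xs) + int (length xs) * (int (length xs) - 1)"
proof -
  have "2 * (\<Sum>i<m. int i) = int m * (int m - 1)" for m
    by (induction m) (simp_all add: algebra_simps)
  then have "2 * (\<Sum>i<length xs. int i) = int (length xs) * (int (length xs) - 1)" .
  moreover have "sum_list (stair xs) = (\<Sum>i<length xs. int (xs ! i)) + (\<Sum>i<length xs. int i)"
    by (simp add: stair_def sum_list_sum_nth atLeast0LessThan sum.distrib)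
  moreover have "int (sum_list xs) = (\<Sum>i<length xs. int (xs ! i))"
    by (simp add: sum_list_sum_nth atLeast0LessThan)
  ultimately show ?thesis by simp
qed

lemma card_staircase_eq_sorted_lists:
  "card (staircase_sets n) = card {xs :: nat list. sorted xs \<and> length xs = n \<and> sum_list xs = n}"
  (is "card ?B = card ?L")
proof -
  have L: "set (stair xs) \<in> ?B \<and> unstair (sorted_list_of_set (set (stair xs))) = xs" if "xs \<in> ?L" for xs
  proof -
    from that have xs: "sorted xs" "length xs = n" "sum_list xs = n" by simp_all
    have ss: "sorted (stair xs)" "distinct (stair xs)"
      using strict_sorted_stair[OF xs(1)] by (simp_all add: strict_sorted_iff)
    have "\<Sum>(set (stair xs)) = sum_list (stair xs)"
      using ss(2) by (simp add: sum_list_distinct_conv_sum_set[of _ "\<lambda>x. x", simplified])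
    then have "set (stair xs) \<in> ?B"
      using sum_stair[of xs] xs distinct_card[OF ss(2)] by (auto simp: staircase_sets_def stair_def)
    moreover have "sorted_list_of_set (set (stair xs)) = stair xs"
      using ss by (rule sorted_list_of_set.idem_if_sorted_distinct)
    ultimately show ?thesis by (simp add: unstair_stair)
  qed
  have B: "unstair (sorted_list_of_set X) \<in> ?L \<and> set (stair (unstair (sorted_list_of_set X))) = X"
    if "X \<in> ?B" for X
  proof -
    from that have X: "finite X" "X \<subseteq> {0..}" "card X = n" "2 * \<Sum>X = 2 * int n + int n * (int n - 1)"
      by (simp_all add: staircase_sets_def)
    define ys where "ys = sorted_list_of_set X"
    have ys: "sorted_wrt (<) ys" "set ys \<subseteq> {0..}" "set ys = X" "distinct ys" "length ys = n"
      using X by (simp_all add: ys_def)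
    have su: "stair (unstair ys) = ys"
      by (rule stair_unstair[OF ys(1,2)])
    have len: "length (unstair ys) = n"
      using ys(5) by (simp add: unstair_def)
    have "\<Sum>X = sum_list ys"
      using ys(3,4) by (simp add: sum_list_distinct_conv_sum_set[of _ "\<lambda>x. x", simplified])
    then have "sum_list (unstair ys) = n"
      using sum_stair[of "unstair ys"] su len X(4) by simp
    then show ?thesis
      using sorted_unstair[OF ys(1,2)] len su ys(3) by (simp add: ys_def)
  qed
  have "bij_betw (\<lambda>xs. set (stair xs)) ?L ?B"
    by (rule bij_betw_byWitness[where f' = "\<lambda>X. unstair (sorted_list_of_set X)"]; intro ballI image_subsetI)
      (fact L[THEN conjunct2] B[THEN conjunct2] L[THEN conjunct1] B[THEN conjunct1])+
  then show ?thesis by (rule bij_betw_same_card[symmetric])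
qed

lemma size_le_sum_mset: "0 \<notin># M \<Longrightarrow> size M \<le> sum_mset (M :: nat multiset)"
  by (induction M) auto

text \<open>A partition of \<open>n\<close> has at most \<open>n\<close> parts, so padding with
  zeros brings it to length exactly \<open>n\<close>; in particular \<open>n - size M\<close> is a
  genuine difference.\<close>

lemma partition_number_eq_sorted_lists:
  "partition_number n = card {xs :: nat list. sorted xs \<and> length xs = n \<and> sum_list xs = n}"
  (is "_ = card ?L")
proof -
  let ?P = "{M :: nat multiset. 0 \<notin># M \<and> sum_mset M = n}"
  let ?f = "\<lambda>xs :: nat list. filter_mset (\<lambda>x. x \<noteq> 0) (mset xs)"
  let ?g = "\<lambda>M. replicate (n - size M) 0 @ sorted_list_of_multiset M"
  have sum_filter: "sum_mset (filter_mset (\<lambda>x. x \<noteq> 0) M) = sum_mset M" for M :: "nat multiset"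
    by (induction M) auto
  have split: "replicate_mset (count M 0) 0 + filter_mset (\<lambda>x. x \<noteq> 0) M = M" for M :: "nat multiset"
    by (rule multiset_eqI) auto
  have L: "?f xs \<in> ?P \<and> ?g (?f xs) = xs" if "xs \<in> ?L" for xs
  proof -
    from that have xs: "sorted xs" "length xs = n" "sum_list xs = n" by simp_all
    have "size (mset xs) = count (mset xs) 0 + size (?f xs)"
      by (metis split size_replicate_mset size_union)
    then have "mset (?g (?f xs)) = mset xs"
      using split[of "mset xs"] xs(2) by simp
    moreover have "sorted (?g (?f xs))"
      by (auto simp: sorted_append)
    ultimately have "?g (?f xs) = xs"
      using xs(1) by (metis properties_for_sort sort_key_id_if_sorted sorted_sort_id)
    moreover have "?f xs \<in> ?P"
      using xs(3) sum_filter[of "mset xs"] by (simp add: sum_mset_sum_list)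
    ultimately show ?thesis by simp
  qed
  have P: "?g M \<in> ?L \<and> ?f (?g M) = M" if "M \<in> ?P" for M
  proof -
    from that have M: "0 \<notin># M" "sum_mset M = n" by simp_all
    have "sorted (?g M)"
      by (auto simp: sorted_append)
    moreover have "length (?g M) = n"
      using size_le_sum_mset[OF M(1)] M(2) by (simp add: size_mset[symmetric] del: size_mset)
    moreover have "sum_list (?g M) = n"
      using M(2) by (simp flip: sum_mset_sum_list)
    moreover have "?f (?g M) = M"
      by (rule multiset_eqI) (use M(1) in \<open>auto simp: not_in_iff\<close>)
    ultimately show ?thesis by simp
  qed
  have "bij_betw ?f ?L ?P"
    by (rule bij_betw_byWitness[where f' = ?g]; intro ballI image_subsetI)
      (fact L[THEN conjunct2] P[THEN conjunct2] L[THEN conjunct1] P[THEN conjunct1])+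
  then show ?thesis
    unfolding partition_number_def by (rule bij_betw_same_card[symmetric])
qed

lemma partition_number_eq_card_maya:
  "partition_number n = card {S. maya S \<and> charge S = 0 \<and> energy S = int n}"
  by (simp only: partition_number_eq_sorted_lists card_staircase_eq_sorted_lists card_charge_zero_eq_staircase)

section \<open>Euler's product\<close>

text \<open>The generating function in \<open>n\<close> is the reciprocal of the first
  \<open>k\<close> factors of the Euler product.\<close>

definition bounded_partitions :: "nat \<Rightarrow> nat \<Rightarrow> nat multiset set" where
  "bounded_partitions k n = {M. set_mset M \<subseteq> {1..k} \<and> sum_mset M = n}"

lemma bounded_partitions_subset: "bounded_partitions k n \<subseteq> {M. 0 \<notin># M \<and> sum_mset M = n}"
  by (auto simp: bounded_partitions_def)

lemma finite_bounded_partitions: "finite (bounded_partitions k n)"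
  using bounded_partitions_subset finite_partitions by (rule finite_subset)

lemma card_bounded_partitions_le: "card (bounded_partitions k n) \<le> partition_number n"
  unfolding partition_number_def
  by (rule card_mono[OF finite_partitions bounded_partitions_subset])

lemma card_bounded_partitions_eq:
  assumes "n \<le> k"
  shows "card (bounded_partitions k n) = partition_number n"
proof -
  have "x \<le> sum_mset M" if "x \<in># M" for x and M :: "nat multiset"
    using that by (metis le_add1 multi_member_split sum_mset.add_mset)
  then have "set_mset M \<subseteq> {1..k}" if "0 \<notin># M" "sum_mset M = n" for M :: "nat multiset"
    using that assms by (fastforce simp: Suc_le_eq intro: gr0I)
  then have "bounded_partitions k n = {M. 0 \<notin># M \<and> sum_mset M = n}"
    by (auto simp: bounded_partitions_def)
  then show ?thesis by (simp add: partition_number_def)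
qed

lemma card_bounded_partitions_0: "card (bounded_partitions 0 n) = of_bool (n = 0)"
proof -
  have "bounded_partitions 0 n = (if n = 0 then {{#}} else {})"
    by (auto simp: bounded_partitions_def)
  then show ?thesis by simp
qed

text \<open>Split by whether the part \<open>Suc k\<close> occurs. If it does, one copy is removed;
  others may remain, so the bound on the parts stays \<open>Suc k\<close>.\<close>

lemma card_bounded_partitions_Suc:
  "card (bounded_partitions (Suc k) n) = card (bounded_partitions k n) +
    (if Suc k \<le> n then card (bounded_partitions (Suc k) (n - Suc k)) else 0)"
proof -
  let ?A = "add_mset (Suc k) ` {M. set_mset M \<subseteq> {1..Suc k} \<and> Suc k + sum_mset M = n}"
  have "M \<in> bounded_partitions k n \<union> ?A" if M: "M \<in> bounded_partitions (Suc k) n" for M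
  proof (cases "Suc k \<in># M")
    case True
    then obtain M' where M': "M = add_mset (Suc k) M'"
      by (auto dest: multi_member_split)
    with M have "M' \<in> {M. set_mset M \<subseteq> {1..Suc k} \<and> Suc k + sum_mset M = n}"
      by (auto simp: bounded_partitions_def)
    with M' show ?thesis by blast
  next
    case False
    have "x \<le> k" if "x \<in># M" for x
    proof -
      have "x \<in> {1..Suc k}" "x \<noteq> Suc k"
        using M False that by (auto simp: bounded_partitions_def)
      then show ?thesis by simp
    qed
    with M show ?thesis by (auto simp: bounded_partitions_def)
  qed
  moreover have "bounded_partitions k n \<union> ?A \<subseteq> bounded_partitions (Suc k) n"
    by (auto simp: bounded_partitions_def)
  ultimately have split: "bounded_partitions (Suc k) n = bounded_partitions k n \<union> ?A"
    by blast
  have "Suc k \<notin># M" if "M \<in> bounded_partitions k n" for M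
    using that by (force simp: bounded_partitions_def)
  then have disj: "bounded_partitions k n \<inter> ?A = {}"
    by fastforce
  have A: "card ?A = (if Suc k \<le> n then card (bounded_partitions (Suc k) (n - Suc k)) else 0)"
  proof (cases "Suc k \<le> n")
    case True
    then have "{M. set_mset M \<subseteq> {1..Suc k} \<and> Suc k + sum_mset M = n} = bounded_partitions (Suc k) (n - Suc k)"
      by (auto simp: bounded_partitions_def)
    with True show ?thesis by (simp add: card_image inj_on_def)
  next
    case False
    then have "{M. set_mset M \<subseteq> {1..Suc k} \<and> Suc k + sum_mset M = n} = {}" by auto
    with False show ?thesis by simp
  qed
  have "finite ?A"
    by (rule finite_subset[OF _ finite_bounded_partitions[of "Suc k" n]]) (simp add: split)
  then have "card (bounded_partitions (Suc k) n) = card (bounded_partitions k n) + card ?A"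
    unfolding split by (intro card_Un_disjoint finite_bounded_partitions disj)
  with A show ?thesis by simp
qed

text \<open>Truncated sums make the argument independent of convergence, which it serves to prove.
  Truncating the recurrence drops only nonnegative terms, hence an inequality.\<close>

lemma sum_bounded_partitions_le:
  fixes r :: real
  assumes "0 \<le> r" "r < 1"
  shows "(\<Sum>n<m. card (bounded_partitions k n) * r ^ n) * (\<Prod>j<k. 1 - r * r ^ j) \<le> 1"
proof (induction k)
  case 0
  have "(\<Sum>n<m. card (bounded_partitions 0 n) * r ^ n) = (\<Sum>n<m. if n = 0 then 1 else 0)"
    by (intro sum.cong refl) (simp add: card_bounded_partitions_0)
  then show ?case by simp
next
  case (Suc k)
  define s where "s k = (\<Sum>n<m. card (bounded_partitions k n) * r ^ n)" for k
  define t where "t n = (if Suc k \<le> n then card (bounded_partitions (Suc k) (n - Suc k)) * r ^ n else 0)" for n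
  have "s (Suc k) = s k + (\<Sum>n<m. t n)"
    unfolding s_def sum.distrib[symmetric]
    by (intro sum.cong refl, subst card_bounded_partitions_Suc) (simp add: t_def distrib_right)
  moreover have "(\<Sum>n<m. t n) \<le> r * r ^ k * s (Suc k)"
  proof -
    \<comment> \<open>The range is lengthened so that, once the first \<open>Suc k\<close> vanishing
      terms are removed, exactly a multiple of \<open>s (Suc k)\<close> remains.\<close>
    have "(\<Sum>n<m. t n) \<le> (\<Sum>n<m + Suc k. t n)"
      using assms by (intro sum_mono2) (auto simp: t_def)
    also have "\<dots> = (\<Sum>n<Suc k. t n) + (\<Sum>n<m. t (n + Suc k))"
      by (induction m) (simp_all add: add.assoc)
    also have "(\<Sum>n<Suc k. t n) = 0"
      by (intro sum.neutral) (auto simp: t_def)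
    also have "(\<Sum>n<m. t (n + Suc k)) = r * r ^ k * s (Suc k)"
      by (simp add: t_def s_def sum_distrib_left power_add mult_ac)
    finally show ?thesis by simp
  qed
  ultimately have "s (Suc k) * (1 - r * r ^ k) \<le> s k"
    by (simp add: algebra_simps)
  moreover have "0 \<le> (\<Prod>j<k. 1 - r * r ^ j)"
    using assms by (intro prod_nonneg) (auto simp: power_le_one mult_le_one)
  ultimately have "s (Suc k) * (1 - r * r ^ k) * (\<Prod>j<k. 1 - r * r ^ j) \<le> s k * (\<Prod>j<k. 1 - r * r ^ j)"
    by (rule mult_right_mono)
  with Suc show ?case by (simp add: s_def mult_ac)
qed

section \<open>Convergence and the passage to the infinite product\<close>

lemma convergent_euler_product:
  fixes q :: "'a :: {real_normed_field, complete_space}"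
  assumes "norm q < 1"
  shows "convergent_prod (\<lambda>j. 1 - q * q ^ j)"
proof -
  have "summable (\<lambda>j. norm q * norm q ^ j)"
    using assms by (intro summable_mult summable_geometric) simp
  then have "summable (\<lambda>j. norm (1 - q * q ^ j - 1))"
    by (simp add: norm_mult norm_power)
  then show ?thesis
    by (intro abs_convergent_prod_imp_convergent_prod summable_imp_abs_convergent_prod)
qed

lemma euler_factor_nonzero:
  fixes q :: "'a :: real_normed_field"
  assumes "norm q < 1"
  shows "1 - q * q ^ j \<noteq> 0"
proof
  assume "1 - q * q ^ j = 0"
  then have "norm (q ^ Suc j) = 1" by simp
  then have "norm q ^ Suc j = 1" by (simp only: norm_power)
  moreover have "norm q ^ Suc j < 1"
    using assms power_Suc_le_self[of "norm q" j] by simp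
  ultimately show False by simp
qed

lemma summable_partition_number_real:
  fixes r :: real
  assumes "0 \<le> r" "r < 1"
  shows "summable (\<lambda>n. partition_number n * r ^ n)"
proof (rule summableI_nonneg_bounded)
  let ?f = "\<lambda>j. 1 - r * r ^ j"
  have conv: "convergent_prod ?f"
    using assms by (intro convergent_euler_product) simp
  have f: "0 < ?f j" "?f j \<le> 1" for j
  proof -
    have "r * r ^ j \<le> r * 1"
      using assms by (intro mult_left_mono power_le_one) auto
    then show "0 < ?f j" "?f j \<le> 1"
      using assms by simp_all
  qed
  have pos: "0 < prodinf ?f"
    using conv f by (intro less_0_prodinf)
  fix m
  let ?s = "\<Sum>n<m. partition_number n * r ^ n"
  have s: "0 \<le> ?s" using assms by (intro sum_nonneg) simp
  \<comment> \<open>For \<open>n < m\<close> the restriction to parts at most \<open>m\<close> is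
    void, so the finite estimate bounds every partial sum by the same constant.\<close>
  have "?s = (\<Sum>n<m. card (bounded_partitions m n) * r ^ n)"
    by (intro sum.cong refl) (simp add: card_bounded_partitions_eq)
  then have "?s * (\<Prod>j<m. ?f j) \<le> 1"
    using sum_bounded_partitions_le[OF assms, of m m] by simp
  moreover have "prodinf ?f \<le> (\<Prod>j<m. ?f j)"
    by (rule prod_ge_prodinf[OF convergent_prod_has_prod[OF conv] less_imp_le[OF f(1)] f(2)])
  ultimately have "?s * prodinf ?f \<le> 1"
    using mult_left_mono[OF _ s, of "prodinf ?f" "\<Prod>j<m. ?f j"] by linarith
  then show "?s \<le> 1 / prodinf ?f"
    using pos by (simp add: field_simps)
qed (use assms in simp)

lemma summable_partition_number:
  fixes q :: "'a :: {real_normed_field, banach}"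
  assumes "norm q < 1"
  shows "summable (\<lambda>n. norm (of_nat (partition_number n) * q ^ n))"
  using summable_partition_number_real[of "norm q"] assms by (simp add: norm_mult norm_power)

text \<open>The series for parts at most \<open>k\<close> times the first \<open>k\<close> factors
  is 1. As \<open>k\<close> grows each coefficient becomes stationary, and the absolutely convergent
  partition series dominates, so Tannery's theorem gives the limit.\<close>

lemma euler_partition_product:
  fixes q :: "'a :: {real_normed_field, banach}"
  assumes "norm q < 1"
  shows "(\<lambda>n. of_nat (partition_number n) * q ^ n) sums (1 / (\<Prod>j. 1 - q * q ^ j))"
proof -
  define b where "b k n = of_nat (card (bounded_partitions k n)) * q ^ n" for k n
  define p where "p n = of_nat (partition_number n) * q ^ n" for n
  have sp: "summable (\<lambda>n. norm (p n))"
    unfolding p_def by (rule summable_partition_number[OF assms])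
  have bp: "norm (b k n) \<le> norm (p n)" for k n
    unfolding b_def p_def norm_mult using card_bounded_partitions_le[of k n]
    by (intro mult_right_mono) simp_all
  have sb: "summable (b k)" for k
    using sp bp by (rule summable_comparison_test'[of _ 0])
  have rec: "suminf (b (Suc k)) * (1 - q * q ^ k) = suminf (b k)" for k
  proof -
    define t where "t n = (if Suc k \<le> n then of_nat (card (bounded_partitions (Suc k) (n - Suc k))) * q ^ n else 0)" for n
    have "t (n + Suc k) = q * q ^ k * b (Suc k) n" for n
      by (simp add: t_def b_def power_add mult_ac)
    then have "(\<lambda>n. t (n + Suc k)) sums (q * q ^ k * suminf (b (Suc k)))"
      using sums_mult[OF summable_sums[OF sb]] by simp
    moreover have "(\<Sum>n<Suc k. t n) = 0"
      by (intro sum.neutral) (auto simp: t_def)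
    ultimately have "t sums (q * q ^ k * suminf (b (Suc k)))"
      by (simp only: sums_iff_shift add_0_right)
    moreover have "b (Suc k) = (\<lambda>n. b k n + t n)"
      unfolding b_def by (rule ext, subst card_bounded_partitions_Suc) (simp add: t_def distrib_right)
    ultimately have "b (Suc k) sums (suminf (b k) + q * q ^ k * suminf (b (Suc k)))"
      using sums_add[OF summable_sums[OF sb[of k]]] by simp
    then have "suminf (b (Suc k)) = suminf (b k) + q * q ^ k * suminf (b (Suc k))"
      by (rule sums_unique[symmetric])
    then show ?thesis by (simp add: algebra_simps)
  qed
  have fin: "suminf (b k) * (\<Prod>j<k. 1 - q * q ^ j) = 1" for k
  proof (induction k)
    case 0
    have "b 0 = (\<lambda>n. if n = 0 then 1 else 0)"
      by (auto simp: b_def card_bounded_partitions_0)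
    then show ?case using sums_unique[OF sums_single[of 0 "\<lambda>_. 1 :: 'a"]] by simp
  next
    case (Suc k)
    have "suminf (b (Suc k)) * (\<Prod>j<Suc k. 1 - q * q ^ j) =
        suminf (b (Suc k)) * (1 - q * q ^ k) * (\<Prod>j<k. 1 - q * q ^ j)"
      by (simp only: prod.lessThan_Suc mult_ac)
    then show ?case by (simp only: rec Suc)
  qed
  have "(\<lambda>k. \<Sum>n. b k n) \<longlonglongrightarrow> suminf p"
  proof (rule tannerys_theorem[where M = "\<lambda>n. norm (p n)", THEN conjunct2, THEN conjunct2])
    show "(\<lambda>k. b k n) \<longlonglongrightarrow> p n" for n
      by (rule tendsto_eventually) (auto simp: eventually_at_top_linorder b_def p_def card_bounded_partitions_eq intro!: exI[of _ n])
    show "eventually (\<lambda>(n, k). norm (b k n) \<le> norm (p n)) (at_top \<times>\<^sub>F at_top)"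
      by (intro always_eventually) (simp add: bp)
  qed (use sp in simp_all)
  moreover have conv: "convergent_prod (\<lambda>j. 1 - q * q ^ j)"
    by (rule convergent_euler_product[OF assms])
  then have "(\<lambda>k. \<Prod>j<k. 1 - q * q ^ j) \<longlonglongrightarrow> (\<Prod>j. 1 - q * q ^ j)"
    using convergent_prod_LIMSEQ LIMSEQ_lessThan_iff_atMost by blast
  ultimately have "(\<lambda>k. suminf (b k) * (\<Prod>j<k. 1 - q * q ^ j)) \<longlonglongrightarrow> suminf p * (\<Prod>j. 1 - q * q ^ j)"
    by (rule tendsto_mult)
  then have "suminf p * (\<Prod>j. 1 - q * q ^ j) = 1"
    by (simp add: fin LIMSEQ_const_iff)
  moreover have "(\<Prod>j. 1 - q * q ^ j) \<noteq> 0"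
    using conv euler_factor_nonzero[OF assms] by (rule prodinf_nonzero)
  ultimately have "suminf p = 1 / (\<Prod>j. 1 - q * q ^ j)"
    by (simp add: field_simps)
  moreover have "summable p"
    using sp by (rule summable_norm_cancel)
  ultimately show ?thesis
    unfolding p_def by (simp add: sums_iff)
qed

section \<open>Coloured Frobenius partitions for eleven colours\<close>

lemma energy_nonneg: "0 \<le> energy S"
  unfolding rsum_def by (intro sum_nonneg) (auto simp: not_less)

text \<open>The case \<open>n = 0\<close> is separate because natural subtraction turns
  \<open>11 * 0 - 5\<close> into 0, whereas no diagram has energy -5.\<close>

lemma cphi_11:
  "cphi 11 n = (if 11 dvd n then partition_number (n div 11) else 0) +
    11 * (if n = 0 then 0 else partition_number (11 * n - 5))"
proof -
  have bij: "bij_betw (\<lambda>(r, t). particles_holes (row_code 11 ` set r, row_code 11 ` set t))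
      (frobenius_partitions 11 n) {S. maya S \<and> charge S = 0 \<and> rsum (\<lambda>s. s div 11) S = int n}"
    using bij_betw_frobenius_partitions[of 11 n] by simp
  have fin: "finite {S. maya S \<and> charge S = 0 \<and> rsum (\<lambda>s. s div 11) S = int n}"
    using bij_betw_finite[OF bij] finite_frobenius_partitions by simp
  have unmixed: "card {S. maya S \<and> charge S = 0 \<and> 11 * energy S = int n} =
      (if 11 dvd n then partition_number (n div 11) else 0)"
  proof (cases "11 dvd n")
    case True
    then obtain m where "n = 11 * m" ..
    then show ?thesis by (simp add: partition_number_eq_card_maya)
  next
    case False
    then have "11 * energy S \<noteq> int n" for S
      by (metis dvd_triv_left int_dvd_int_iff of_nat_numeral)
    with False show ?thesis by simp
  qed
  have mixed: "card {S. maya S \<and> charge S = 0 \<and> energy S = 11 * int n - 5} =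
      (if n = 0 then 0 else partition_number (11 * n - 5))"
  proof (cases "n = 0")
    case True
    have "energy S \<noteq> - 5" for S
      using energy_nonneg[of S] by simp
    with True show ?thesis by simp
  next
    case False
    then have "11 * int n - 5 = int (11 * n - 5)" by simp
    with False show ?thesis by (simp only: partition_number_eq_card_maya if_False)
  qed
  have "cphi 11 n = card {S. maya S \<and> charge S = 0 \<and> rsum (\<lambda>s. s div 11) S = int n}"
    unfolding cphi_def by (rule bij_betw_same_card[OF bij])
  then show ?thesis
    by (simp only: card_eq_unmixed_plus_residue_one[OF fin] card_residue_one_eq unmixed mixed)
qed

theorem theorem3p5:
  fixes q :: complex
  assumes "norm q < 1"
  shows
    "summable (\<lambda>n. of_nat (cphi 11 n) * q ^ n) \<and>
    convergent_prod (\<lambda>j. 1 - q ^ 11 * (q ^ 11) ^ j) \<and>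
    summable (\<lambda>j. of_nat (partition_number (11 * Suc j - 5)) * q ^ Suc j) \<and>
     CPhi 11 q = 1 / qpoch_inf (q ^ 11) (q ^ 11)
           + 11 * (\<Sum>j. of_nat (partition_number (11 * Suc j - 5)) * q ^ Suc j)"
proof -
  have q11: "norm (q ^ 11) < 1"
    unfolding norm_power using assms by (intro power_less_one_iff[THEN iffD2]) simp_all
  \<comment> \<open>The partition series in \<open>q ^ 11\<close>, spread out as a power series in
    \<open>q\<close> with support on the multiples of 11.\<close>
  define a where "a n = (if 11 dvd n then of_nat (partition_number (n div 11)) * q ^ n else 0)" for n
  define c where "c n = (if n = 0 then 0 else of_nat (partition_number (11 * n - 5)) * q ^ n)" for n
  have "strict_mono (\<lambda>m::nat. 11 * m)"
    by (rule strict_monoI) simp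
  moreover have "a n = 0" if "n \<notin> range (\<lambda>m. 11 * m)" for n
    using that by (auto simp: a_def elim!: dvdE)
  ultimately have "(\<lambda>m. a (11 * m)) sums s \<longleftrightarrow> a sums s" for s
    by (rule sums_mono_reindex)
  moreover have "a (11 * m) = of_nat (partition_number m) * (q ^ 11) ^ m" for m
    by (simp add: a_def power_mult)
  ultimately have a: "a sums (1 / qpoch_inf (q ^ 11) (q ^ 11))"
    using euler_partition_product[OF q11] by (simp add: qpoch_inf_def)
  \<comment> \<open>With \<open>r\<close> the eleventh root of \<open>norm q\<close>, the term with
    index \<open>j\<close> has factor \<open>r ^ (11 * Suc j) <= r ^ (11 * j + 6)\<close>. The
    partition series at \<open>r\<close>, restricted to the indices
    \<open>11 * j + 6 = 11 * Suc j - 5\<close>, is thus a majorant.\<close>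
  define r where "r = root 11 (norm q)"
  have r: "0 \<le> r" "r < 1" "norm q = r ^ 11"
    using assms by (simp_all add: r_def)
  have "summable ((\<lambda>n. real (partition_number n) * r ^ n) \<circ> (\<lambda>j. 11 * j + 6))"
    using r by (intro summable_reindex summable_partition_number_real) (auto simp: inj_def)
  then have sc: "summable (\<lambda>j. of_nat (partition_number (11 * Suc j - 5)) * q ^ Suc j)"
  proof (rule summable_comparison_test'[of _ 0])
    fix j
    have "r ^ (11 * Suc j) \<le> r ^ (11 * j + 6)"
      using r by (intro power_decreasing) auto
    then have "real (partition_number (11 * j + 6)) * r ^ (11 * Suc j)
        \<le> real (partition_number (11 * j + 6)) * r ^ (11 * j + 6)"
      by (rule mult_left_mono) simp
    then show "norm (of_nat (partition_number (11 * Suc j - 5)) * q ^ Suc j)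
        \<le> ((\<lambda>n. real (partition_number n) * r ^ n) \<circ> (\<lambda>j. 11 * j + 6)) j"
      unfolding norm_mult norm_power r(3) power_mult[symmetric] by (simp add: add.commute)
  qed
  then have "(\<lambda>j. c (Suc j)) sums (\<Sum>j. of_nat (partition_number (11 * Suc j - 5)) * q ^ Suc j)"
    unfolding c_def by (simp only: nat.distinct if_False summable_sums)
  then have c: "c sums (\<Sum>j. of_nat (partition_number (11 * Suc j - 5)) * q ^ Suc j)"
    by (simp only: sums_Suc_iff) (simp add: c_def)
  have "of_nat (cphi 11 n) * q ^ n = a n + 11 * c n" for n
    unfolding cphi_11 a_def c_def by (simp add: distrib_right)
  then have "(\<lambda>n. of_nat (cphi 11 n) * q ^ n) sums (1 / qpoch_inf (q ^ 11) (q ^ 11)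
      + 11 * (\<Sum>j. of_nat (partition_number (11 * Suc j - 5)) * q ^ Suc j))"
    using sums_add[OF a sums_mult[OF c, of 11]] by simp
  then show ?thesis
    using sc convergent_euler_product[OF q11] unfolding CPhi_def sums_iff by simp
qed

end
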